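(* Let $3\le\xi<\omega_1$. Then the sets $\mathbf{\Sigma}_\xi:=\{A\subseteq2^{<\omega}\mid A^\infty\in\mathbf{\Sigma}^0_\xi\}$ and $\mathbf{\Pi}_\xi:=\{A\subseteq2^{<\omega}\mid A^\infty\in\mathbf{\Pi}^0_\xi\}$ are $\mathbf{\Pi}^1_1$-hard (and also belong to $\mathbf{\Sigma}^1_2(2^{2^{<\omega}})\setminus\mathbf{\Sigma}^1_1$).
   Context: $2^{<\omega}$ is the set of finite words over $\{0,1\}$, and for $A\subseteq2^{<\omega}$, $A^\infty:=\{a_0a_1\ldots\in2^\omega\mid\forall i\in\omega\ a_i\in A\}\subseteq2^\omega$. The power set of $2^{<\omega}$ is identified with $2^{2^{<\omega}}$ with the product topology (a Cantor space). $\mathbf{\Sigma}^0_\xi,\mathbf{\Pi}^0_\xi$ are the boldface Borel classes and $\mathbf{\Sigma}^1_n,\mathbf{\Pi}^1_n$ the boldface projective classes. A subset $A$ of a zero-dimensional Polish space $X$ is $\mathbf{\Gamma}$-hard if for every zero-dimensional Polish space $X'$ and every $A'\in\mathbf{\Gamma}(X')$ there is a continuous $f:X'\to X$ with $A'=f^{-1}(A)$. *)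

theory Defs
  imports "HOL-Analysis.Analysis" "HOL-Library.Countable_Set_Type"
begin

section \<open>The ordinals below \<open>\<omega>\<^sub>1\<close>\<close>

text \<open>\<open>cardSuc natLeq\<close> is a well-order of type \<open>\<omega>\<^sub>1\<close>, so the elements of its field stand for
  the countable ordinals.\<close>

typedef omega1 = "Field (cardSuc natLeq)"
proof -
  have "infinite (Field (cardSuc natLeq))"
    using cardSuc_finite[OF natLeq_Card_order] by (simp add: Field_natLeq)
  then show ?thesis
    by (metis ex_in_conv finite.emptyI)
qed

instantiation omega1 :: wellorder
begin

definition less_eq_omega1 :: "omega1 \<Rightarrow> omega1 \<Rightarrow> bool" where
  "\<alpha> \<le> \<beta> \<longleftrightarrow> (Rep_omega1 \<alpha>, Rep_omega1 \<beta>) \<in> cardSuc natLeq"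

definition less_omega1 :: "omega1 \<Rightarrow> omega1 \<Rightarrow> bool" where
  "\<alpha> < \<beta> \<longleftrightarrow> \<alpha> \<le> \<beta> \<and> \<alpha> \<noteq> (\<beta>::omega1)"

instance
proof -
  let ?r = "cardSuc natLeq"
  have "Well_order ?r"
    using cardSuc_Card_order[OF natLeq_Card_order] unfolding card_order_on_def by blast
  then have lin: "Linear_order ?r" and wf: "wf (?r - Id)"
    unfolding well_order_on_def by auto
  then have rfl: "refl_on (Field ?r) ?r" and tr: "trans ?r" and anti: "antisym ?r"
    and tot: "total_on (Field ?r) ?r"
    unfolding linear_order_on_def partial_order_on_def preorder_on_def by auto
  show "OFCLASS(omega1, wellorder_class)"
  proof
    fix x y z :: omega1
    show le_refl: "x \<le> x"
      using rfl Rep_omega1 unfolding less_eq_omega1_def refl_on_def by blast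
    show "x \<le> y \<Longrightarrow> y \<le> z \<Longrightarrow> x \<le> z"
      using tr unfolding less_eq_omega1_def by (meson transD)
    show le_anti: "x \<le> y \<Longrightarrow> y \<le> x \<Longrightarrow> x = y"
      using anti unfolding less_eq_omega1_def by (metis Rep_omega1_inject antisymD)
    show "(x < y) = (x \<le> y \<and> \<not> y \<le> x)"
      unfolding less_omega1_def using le_anti le_refl by blast
    show "x \<le> y \<or> y \<le> x"
      using tot Rep_omega1 le_refl unfolding less_eq_omega1_def total_on_def
      by (metis Rep_omega1_inject)
  next
    fix P :: "omega1 \<Rightarrow> bool" and a
    assume step: "\<And>x. (\<And>y. y < x \<Longrightarrow> P y) \<Longrightarrow> P x"
    have "wf (inv_image (?r - Id) Rep_omega1)"
      using wf by (rule wf_inv_image)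
    then show "P a"
    proof (induction a rule: wf_induct_rule)
      case (less x)
      then show ?case
        using step unfolding less_omega1_def less_eq_omega1_def
        by (auto simp: Rep_omega1_inject)
    qed
  qed
qed

end

lemma countable_below_omega1:
  includes cardinal_syntax
  shows "countable {..<\<alpha>::omega1}"
proof -
  let ?r = "cardSuc natLeq"
  have "|underS ?r (Rep_omega1 \<alpha>)| <o ?r"
    by (rule card_of_underS[OF cardSuc_Card_order[OF natLeq_Card_order] Rep_omega1])
  then have "|underS ?r (Rep_omega1 \<alpha>)| \<le>o natLeq"
    using cardSuc_ordLeq_ordLess[OF natLeq_Card_order card_of_Card_order] by blast
  then have "countable (underS ?r (Rep_omega1 \<alpha>))"
    by (meson countable_card_le_natLeq)
  moreover have "Rep_omega1 ` {..<\<alpha>} \<subseteq> underS ?r (Rep_omega1 \<alpha>)"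
    by (auto simp: underS_def less_omega1_def less_eq_omega1_def Rep_omega1_inject)
  ultimately show ?thesis
    by (metis Rep_omega1_inject countable_image_inj_on countable_subset inj_onI)
qed

lemma uncountable_omega1:
  includes cardinal_syntax
  shows "uncountable (UNIV :: omega1 set)"
proof
  let ?r = "cardSuc natLeq"
  assume "countable (UNIV :: omega1 set)"
  then have "countable (Field ?r)"
    using countable_image[of UNIV Rep_omega1] type_definition.Rep_range[OF type_definition_omega1]
    by auto
  then have "|Field ?r| \<le>o natLeq"
    using countable_card_le_natLeq by blast
  moreover have "natLeq <o |Field ?r|"
    using cardSuc_greater[OF natLeq_Card_order]
      card_of_Field_ordIso[OF cardSuc_Card_order[OF natLeq_Card_order]]
    by (meson ordIso_symmetric ordLess_ordIso_trans)
  ultimately show False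
    by (simp add: not_ordLess_ordLeq)
qed

text \<open>The finite ordinals, as elements of \<open>\<omega>\<^sub>1\<close>.\<close>

primrec fin_ord :: "nat \<Rightarrow> omega1" where
  "fin_ord 0 = (LEAST \<alpha>. True)"
| "fin_ord (Suc n) = (LEAST \<alpha>. fin_ord n < \<alpha>)"

lemma fin_ord_below: "{..<fin_ord n} = fin_ord ` {..<n}"
proof (induction n)
  case 0
  have "fin_ord 0 \<le> \<alpha>" for \<alpha>
    by (simp add: Least_le)
  then show ?case
    by (auto simp: leD simp del: fin_ord.simps)
next
  case (Suc n)
  have "\<exists>\<alpha>. fin_ord n < \<alpha>"
  proof (rule ccontr)
    assume "\<nexists>\<alpha>. fin_ord n < \<alpha>"
    then have "UNIV = insert (fin_ord n) {..<fin_ord n}"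
      by (auto simp: not_less le_less)
    then show False
      using countable_below_omega1 uncountable_omega1 by (metis countable_insert)
  qed
  then have "fin_ord n < fin_ord (Suc n)"
    using LeastI_ex[of "\<lambda>\<alpha>. fin_ord n < \<alpha>"] by simp
  moreover have "\<alpha> \<le> fin_ord n" if "\<alpha> < fin_ord (Suc n)" for \<alpha>
    using that not_less_Least[of \<alpha> "\<lambda>\<alpha>. fin_ord n < \<alpha>"] by (simp add: not_less)
  ultimately have "{..<fin_ord (Suc n)} = insert (fin_ord n) {..<fin_ord n}"
    by (auto simp: le_less simp del: fin_ord.simps)
  then show ?case
    by (simp add: Suc.IH lessThan_Suc)
qed


section \<open>Polish spaces and boldface classes\<close>

text \<open>Spaces are topologies in the sense of \<^typ>\<open>'a topology\<close>, and every class is a set of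
  subsets of the space.\<close>

definition zero_dim_polish :: "'a topology \<Rightarrow> bool" where
  "zero_dim_polish X \<longleftrightarrow> completely_metrizable_space X \<and> second_countable X \<and> X dim_le 0"

text \<open>The additive levels, indexed from 1: a set of level \<open>\<xi> > 1\<close> is a countable union of
  complements of sets of levels \<open>1 \<le> \<eta>\<^sub>n < \<xi>\<close>. Level 0 is empty.\<close>

inductive borel_level :: "'a topology \<Rightarrow> omega1 \<Rightarrow> 'a set \<Rightarrow> bool" for X where
  open_level: "openin X U \<Longrightarrow> borel_level X (fin_ord 1) U"
| union_level: "(\<And>n::nat. fin_ord 1 \<le> \<eta> n \<and> \<eta> n < \<xi> \<and> borel_level X (\<eta> n) (S n))
    \<Longrightarrow> borel_level X \<xi> (\<Union>n. topspace X - S n)"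

definition Sigma0 :: "omega1 \<Rightarrow> 'a topology \<Rightarrow> 'a set set" where
  "Sigma0 \<xi> X = {S. borel_level X \<xi> S}"

definition Pi0 :: "omega1 \<Rightarrow> 'a topology \<Rightarrow> 'a set set" where
  "Pi0 \<xi> X = {topspace X - S | S. S \<in> Sigma0 \<xi> X}"

definition baire_space :: "(nat \<Rightarrow> nat) topology" where
  "baire_space = product_topology (\<lambda>_. discrete_topology UNIV) UNIV"

text \<open>The projective classes are obtained by projecting along the Baire space, starting from
  closed sets.\<close>

definition Sigma11 :: "'a topology \<Rightarrow> 'a set set" where
  "Sigma11 X = {fst ` C | C. closedin (prod_topology X baire_space) C}"

definition Pi11 :: "'a topology \<Rightarrow> 'a set set" where
  "Pi11 X = {topspace X - S | S. S \<in> Sigma11 X}"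

definition Sigma12 :: "'a topology \<Rightarrow> 'a set set" where
  "Sigma12 X = {fst ` C | C. C \<in> Pi11 (prod_topology X baire_space)}"

text \<open>The test spaces \<open>X'\<close> range over all topologies carried by subsets of the type \<open>'b\<close>. A
  definition cannot quantify over \<open>'b\<close>; hardness in the usual sense is the assertion for
  arbitrary \<open>'b\<close>.\<close>

definition class_hard :: "('b topology \<Rightarrow> 'b set set) \<Rightarrow> 'a topology \<Rightarrow> 'a set \<Rightarrow> bool" where
  "class_hard \<Gamma> X A \<longleftrightarrow> A \<subseteq> topspace X \<and>
    (\<forall>X' A'. zero_dim_polish X' \<and> A' \<in> \<Gamma> X' \<longrightarrow>
      (\<exists>f. continuous_map X' X f \<and> A' = {x \<in> topspace X'. f x \<in> A}))"


section \<open>\<open>\<omega>\<close>-powers\<close>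

definition cantor_space :: "(nat \<Rightarrow> bool) topology" where
  "cantor_space = product_topology (\<lambda>_. discrete_topology UNIV) UNIV"

text \<open>The topology on the power set of the set of finite binary words that is transported from
  the product topology by identifying a set with its characteristic function.\<close>

definition lang_space :: "bool list set topology" where
  "lang_space = pullback_topology UNIV (\<lambda>A w. w \<in> A)
    (product_topology (\<lambda>_. discrete_topology UNIV) UNIV)"

text \<open>\<open>x = a\<^sub>0a\<^sub>1\<dots>\<close>: all finite concatenations are prefixes of \<open>x\<close>, and their lengths are
  unbounded. The second clause is needed because the \<open>a\<^sub>i\<close> may be empty; a concatenation that is
  only a finite word is not a point of the Cantor space.\<close>

definition inf_concat :: "(nat \<Rightarrow> 'a list) \<Rightarrow> (nat \<Rightarrow> 'a) \<Rightarrow> bool" where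
  "inf_concat a x \<longleftrightarrow>
    (\<forall>n. let p = concat (map a [0..<n]) in p = map x [0..<length p]) \<and>
    (\<forall>k. \<exists>n. k \<le> length (concat (map a [0..<n])))"

definition omega_power :: "'a list set \<Rightarrow> (nat \<Rightarrow> 'a) set" where
  "omega_power A = {x. \<exists>a. (\<forall>i. a i \<in> A) \<and> inf_concat a x}"

definition Sigma_langs :: "omega1 \<Rightarrow> bool list set set" where
  "Sigma_langs \<xi> = {A. omega_power A \<in> Sigma0 \<xi> cantor_space}"

definition Pi_langs :: "omega1 \<Rightarrow> bool list set set" where
  "Pi_langs \<xi> = {A. omega_power A \<in> Pi0 \<xi> cantor_space}"

end

theory Submission
  imports Defs
begin

text \<open>Hardness. Fix an analytic set \<open>D\<close> of the Baire space that is not Borel. For a coanalytic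
  \<open>A'\<close>, a point \<open>x\<close> is turned into the language of those words that, over an infinite alphabet,
  either make a detectable error or perform one step of a walk through the product of a tree for
  \<open>x \<notin> A'\<close> with the tree for \<open>D\<close>. A factor remembers the node it starts from by its position, so
  sequences without errors reduce \<open>D\<close> to the \<open>\<omega>\<close>-power as soon as the tree of \<open>x\<close> has a branch.
  If it has none, only the sequences with infinitely many errors remain, and these form a
  \<open>G\<^sub>\<delta>\<close> set.

  Upper bound. The \<open>\<omega>\<close>-power \<open>A\<^sup>\<infinity>\<close> is the largest set each of whose points has a nonempty prefix in
  \<open>A\<close> with remainder in the set. So a Borel set \<open>B\<close> equals \<open>A\<^sup>\<infinity>\<close> iff \<open>A\<^sup>\<infinity> \<subseteq> B\<close> and \<open>B\<close> has this
  property, which is a coanalytic condition on \<open>A\<close> and a code of \<open>B\<close>.\<close>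

section \<open>Locally constant functions\<close>

text \<open>The difficulty is that an \<omega>-power cannot make one factor depend on the previous
  one, so products of steps that do not fit together could be more complicated than any walk. Two
  devices deal with this. Every letter codes a finite sequence and should extend its predecessor by
  one entry; so without errors the letters count positions up to a shift, and a step that does not
  continue the previous one leaves an error at the border. As \<open>D\<close> lies outside all
  Borel levels at once, the reduction is independent of \<xi>; 3 is the level from which a G-delta
  set belongs to both classes. That an \<omega>-power is not Borel is shown by pulling it back to
  \<open>D\<close> within the sets that are analytic together with their complement.\<close>

definition loc_const :: "'a topology \<Rightarrow> ('a \<Rightarrow> 'c) \<Rightarrow> bool" where
  "loc_const X g \<longleftrightarrow> (\<forall>v. openin X {x \<in> topspace X. g x = v})"

lemma loc_const_continuous: "loc_const X g \<longleftrightarrow> continuous_map X (discrete_topology UNIV) g"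
proof
  assume g: "loc_const X g"
  have "openin X {x \<in> topspace X. g x \<in> U}" for U
  proof -
    have "{x \<in> topspace X. g x \<in> U} = (\<Union>v\<in>U. {x \<in> topspace X. g x = v})" by auto
    also have "openin X \<dots>" using g by (auto simp: loc_const_def)
    finally show ?thesis .
  qed
  then show "continuous_map X (discrete_topology UNIV) g" by (simp add: continuous_map)
next
  assume "continuous_map X (discrete_topology UNIV) g"
  then have "openin X {x \<in> topspace X. g x \<in> {v}}" for v
    by (rule openin_continuous_map_preimage) simp
  then show "loc_const X g" by (simp add: loc_const_def)
qed

lemma loc_const_const [intro, simp]: "loc_const X (\<lambda>x. c)"
  by (simp add: loc_const_continuous)

text \<open>A value read from x may decide what is read next, for instance a letter at a position
  that is itself read from x. On each of the open sets where the first value is fixed, only one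
  continuation is used.\<close>

lemma loc_const_bind:
  assumes "loc_const X g" and "\<And>v. loc_const X (h v)"
  shows "loc_const X (\<lambda>x. h (g x) x)"
  unfolding loc_const_def
proof
  fix v
  have "{x \<in> topspace X. h (g x) x = v} =
      (\<Union>u. {x \<in> topspace X. g x = u} \<inter> {x \<in> topspace X. h u x = v})" by auto
  also have "openin X \<dots>" using assms unfolding loc_const_def by (intro openin_Union) (blast intro: openin_Int)
  finally show "openin X {x \<in> topspace X. h (g x) x = v}" .
qed

lemma loc_const_comp: "loc_const X g \<Longrightarrow> loc_const X (\<lambda>x. F (g x))"
  using loc_const_bind[of X g "\<lambda>v x. F v"] by simp

lemma loc_const_comp2: "loc_const X g \<Longrightarrow> loc_const X h \<Longrightarrow> loc_const X (\<lambda>x. F (g x) (h x))"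
  by (rule loc_const_bind[of X g "\<lambda>v x. F v (h x)"]) (auto intro: loc_const_comp)

lemma loc_const_compose:
  "loc_const Y g \<Longrightarrow> continuous_map X Y f \<Longrightarrow> loc_const X (\<lambda>x. g (f x))"
  unfolding loc_const_continuous using continuous_map_compose[of X Y f _ g] by (simp add: o_def)

lemma loc_const_openin: "loc_const X P \<Longrightarrow> openin X {x \<in> topspace X. P x}"
  unfolding loc_const_def by (drule spec[of _ True]) simp

lemma loc_const_closedin:
  assumes "loc_const X P"
  shows "closedin X {x \<in> topspace X. P x}"
proof -
  have "topspace X - {x \<in> topspace X. P x} = {x \<in> topspace X. \<not> P x}" by auto
  with loc_const_openin[OF loc_const_comp[OF assms, of Not]] show ?thesis
    by (simp add: closedin_def)
qed

lemma closedin_All: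
  assumes "\<And>i. closedin X {x \<in> topspace X. P i x}"
  shows "closedin X {x \<in> topspace X. \<forall>i. P i x}"
proof -
  have "{x \<in> topspace X. \<forall>i. P i x} = (\<Inter>i. {x \<in> topspace X. P i x})" by auto
  also have "closedin X \<dots>" using assms by (intro closedin_Inter) auto
  finally show ?thesis .
qed

lemma loc_const_clopen:
  assumes "closedin X A" "openin X A"
  shows "loc_const X (\<lambda>x. x \<in> A)"
  unfolding loc_const_def
proof
  fix v
  have "{x \<in> topspace X. (x \<in> A) = v} = (if v then A else topspace X - A)"
    using openin_subset[OF assms(2)] by auto
  then show "openin X {x \<in> topspace X. (x \<in> A) = v}" using assms by auto
qed

section \<open>Topology of sequence spaces and of the space of languages\<close>

abbreviation seq_space :: "(nat \<Rightarrow> 'a) topology" where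
  "seq_space \<equiv> product_topology (\<lambda>_. discrete_topology UNIV) UNIV"

lemma topspace_baire [simp]: "topspace baire_space = UNIV"
  by (simp add: baire_space_def)

lemma topspace_cantor [simp]: "topspace cantor_space = UNIV"
  by (simp add: cantor_space_def)

lemma topspace_lang [simp]: "topspace lang_space = UNIV"
  by (simp add: lang_space_def topspace_pullback_topology)

lemma openin_seq_space:
  "openin seq_space U \<longleftrightarrow> (\<forall>x\<in>U. \<exists>n. \<forall>y. (\<forall>i<n. y i = x i) \<longrightarrow> y \<in> U)"
proof (intro iffI ballI)
  fix x assume U: "openin seq_space U" "x \<in> U"
  obtain V where V: "x \<in> (\<Pi>\<^sub>E i\<in>UNIV. V i)"
    "finite {i. V i \<noteq> topspace (discrete_topology UNIV)}" "(\<Pi>\<^sub>E i\<in>UNIV. V i) \<subseteq> U"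
    using product_topology_open_contains_basis[OF U] by blast
  obtain n where n: "{i. V i \<noteq> UNIV} \<subseteq> {..<n}"
    using finite_nat_iff_bounded[of "{i. V i \<noteq> UNIV}"] V(2) by auto
  have "y \<in> U" if y: "\<forall>i<n. y i = x i" for y
  proof -
    have "y i \<in> V i" for i
    proof (cases "V i = UNIV")
      case False
      then have "i < n" using n by auto
      then show ?thesis using y V(1) by (auto simp: PiE_iff)
    qed simp
    then show ?thesis using V(3) by auto
  qed
  then show "\<exists>n. \<forall>y. (\<forall>i<n. y i = x i) \<longrightarrow> y \<in> U" by blast
next
  assume *: "\<forall>x\<in>U. \<exists>n. \<forall>y. (\<forall>i<n. y i = x i) \<longrightarrow> y \<in> U"
  show "openin seq_space U"
  proof (subst openin_subopen, intro ballI)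
    fix x assume "x \<in> U"
    with * obtain n where n: "\<forall>y. (\<forall>i<n. y i = x i) \<longrightarrow> y \<in> U" by blast
    let ?V = "\<lambda>i. if i < n then {x i} else UNIV"
    have "openin seq_space (\<Pi>\<^sub>E i\<in>UNIV. ?V i)"
      by (rule product_topology_basis) (auto intro: finite_subset[of _ "{..<n}"])
    moreover have "x \<in> (\<Pi>\<^sub>E i\<in>UNIV. ?V i)" by auto
    moreover have "(\<Pi>\<^sub>E i\<in>UNIV. ?V i) \<subseteq> U"
    proof
      fix y assume y: "y \<in> (\<Pi>\<^sub>E i\<in>UNIV. ?V i)"
      have "y i = x i" if "i < n" for i using PiE_mem[OF y, of i] that by simp
      then show "y \<in> U" using n by blast
    qed
    ultimately show "\<exists>T. openin seq_space T \<and> x \<in> T \<and> T \<subseteq> U" by blast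
  qed
qed

lemma continuous_map_seq_space:
  "continuous_map X seq_space f \<longleftrightarrow> (\<forall>i. loc_const X (\<lambda>x. f x i))"
  by (simp add: continuous_map_componentwise_UNIV loc_const_continuous)

lemma continuous_map_baire: "continuous_map X baire_space f \<longleftrightarrow> (\<forall>i. loc_const X (\<lambda>x. f x i))"
  unfolding baire_space_def by (rule continuous_map_seq_space)

lemma continuous_map_cantor: "continuous_map X cantor_space f \<longleftrightarrow> (\<forall>i. loc_const X (\<lambda>x. f x i))"
  unfolding cantor_space_def by (rule continuous_map_seq_space)

lemma loc_const_baire: "continuous_map X baire_space f \<Longrightarrow> loc_const X (\<lambda>x. f x i)"
  by (simp add: continuous_map_baire)

lemma loc_const_cantor: "continuous_map X cantor_space f \<Longrightarrow> loc_const X (\<lambda>x. f x i)"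
  by (simp add: continuous_map_cantor)

lemma loc_const_map_upt:
  assumes "\<And>i. loc_const X (\<lambda>x. f x i)"
  shows "loc_const X (\<lambda>x. map (f x) [a..<b])"
proof (induction b)
  case (Suc b)
  have "loc_const X (\<lambda>x. map (f x) [a..<b] @ [f x b])"
    by (rule loc_const_comp2[OF Suc assms])
  then show ?case by (cases "a \<le> b") auto
qed auto

lemma continuous_map_lang:
  "continuous_map X lang_space f \<longleftrightarrow> (\<forall>w. loc_const X (\<lambda>x. w \<in> f x))"
proof
  let ?P = "product_topology (\<lambda>_. discrete_topology UNIV) UNIV"
  assume f: "continuous_map X lang_space f"
  have "continuous_map lang_space (discrete_topology UNIV) ((\<lambda>g. g w) \<circ> (\<lambda>A w. w \<in> A))" for w :: "bool list"
    unfolding lang_space_def by (intro continuous_map_pullback continuous_map_product_projection) simp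
  then have "continuous_map lang_space (discrete_topology UNIV) (\<lambda>A. w \<in> A)" for w :: "bool list"
    by (simp add: o_def)
  then show "\<forall>w. loc_const X (\<lambda>x. w \<in> f x)"
    using loc_const_compose[OF _ f] by (auto simp: loc_const_continuous)
next
  assume "\<forall>w. loc_const X (\<lambda>x. w \<in> f x)"
  then show "continuous_map X lang_space f"
    unfolding lang_space_def
    by (intro continuous_map_pullback') (auto simp: continuous_map_componentwise_UNIV loc_const_continuous o_def)
qed

lemma loc_const_lang: "continuous_map X lang_space f \<Longrightarrow> loc_const X (\<lambda>x. w \<in> f x)"
  by (simp add: continuous_map_lang)

section \<open>Analytic sets\<close>

lemma Sigma11_subset: "S \<in> Sigma11 X \<Longrightarrow> S \<subseteq> topspace X"
  by (force simp: Sigma11_def dest: closedin_subset)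

text \<open>Stating the closed set by a predicate reduces closure properties to substituting
  continuous terms for the point and its witness.\<close>

lemma Sigma11I:
  assumes "closedin (prod_topology X baire_space) {p \<in> topspace X \<times> UNIV. C p}"
    and "\<And>x. x \<in> S \<longleftrightarrow> x \<in> topspace X \<and> (\<exists>\<alpha>. C (x, \<alpha>))"
  shows "S \<in> Sigma11 X"
proof -
  have "S = fst ` {p \<in> topspace X \<times> UNIV. C p}" using assms(2) by force
  then show ?thesis using assms(1) unfolding Sigma11_def by blast
qed

lemma Sigma11D:
  assumes "S \<in> Sigma11 X"
  shows "\<exists>C. closedin (prod_topology X baire_space) {p \<in> topspace X \<times> UNIV. C p} \<and>
    (\<forall>x. x \<in> S \<longleftrightarrow> x \<in> topspace X \<and> (\<exists>\<alpha>. C (x, \<alpha>)))"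
proof -
  obtain C where C: "closedin (prod_topology X baire_space) C" "S = fst ` C"
    using assms by (auto simp: Sigma11_def)
  then have "C \<subseteq> topspace X \<times> UNIV" using closedin_subset by fastforce
  then have "{p \<in> topspace X \<times> UNIV. p \<in> C} = C" by auto
  moreover have "x \<in> S \<longleftrightarrow> x \<in> topspace X \<and> (\<exists>\<alpha>. (x, \<alpha>) \<in> C)" for x
    using C \<open>C \<subseteq> _\<close> by force
  ultimately show ?thesis using C by (intro exI[of _ "\<lambda>p. p \<in> C"]) simp
qed

lemma continuous_map_topspace: "continuous_map X Y f \<Longrightarrow> x \<in> topspace X \<Longrightarrow> f x \<in> topspace Y"
  using continuous_map_image_subset_topspace by fast

lemma continuous_map_fst': "continuous_map X Y f \<Longrightarrow> continuous_map (prod_topology X Z) Y (\<lambda>p. f (fst p))"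
  using continuous_map_compose[OF continuous_map_fst] by (simp add: o_def)

lemma closedin_preimage_pred:
  assumes "closedin (prod_topology X baire_space) {p \<in> topspace X \<times> UNIV. C p}"
    and f: "continuous_map Y X f" and g: "continuous_map Y baire_space g"
  shows "closedin Y {y \<in> topspace Y. C (f y, g y)}"
proof -
  have "continuous_map Y (prod_topology X baire_space) (\<lambda>y. (f y, g y))"
    using f g by (rule continuous_map_pairedI)
  from closedin_continuous_map_preimage[OF this assms(1)]
  have "closedin Y {y \<in> topspace Y. f y \<in> topspace X \<and> C (f y, g y)}" by simp
  moreover have "{y \<in> topspace Y. f y \<in> topspace X \<and> C (f y, g y)} = {y \<in> topspace Y. C (f y, g y)}"
    using continuous_map_topspace[OF f] by blast
  ultimately show ?thesis by simp
qed

lemma Sigma11_closedin: "closedin X C \<Longrightarrow> C \<in> Sigma11 X"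
proof (rule Sigma11I[where C="\<lambda>p. fst p \<in> C"])
  assume C: "closedin X C"
  have "closedin (prod_topology X baire_space) {p \<in> topspace (prod_topology X baire_space). fst p \<in> C}"
    by (rule closedin_continuous_map_preimage[OF continuous_map_fst C])
  then show "closedin (prod_topology X baire_space) {p \<in> topspace X \<times> UNIV. fst p \<in> C}" by simp
  show "x \<in> C \<longleftrightarrow> x \<in> topspace X \<and> (\<exists>\<alpha>. fst (x, \<alpha>) \<in> C)" for x
    using closedin_subset[OF C] by auto
qed

lemma Sigma11_preimage:
  assumes "S \<in> Sigma11 Y" and f: "continuous_map X Y f"
  shows "{x \<in> topspace X. f x \<in> S} \<in> Sigma11 X"
proof -
  obtain C where C: "closedin (prod_topology Y baire_space) {p \<in> topspace Y \<times> UNIV. C p}"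
    "\<And>x. x \<in> S \<longleftrightarrow> x \<in> topspace Y \<and> (\<exists>\<alpha>. C (x, \<alpha>))" using Sigma11D[OF assms(1)] by blast
  have "closedin (prod_topology X baire_space)
      {p \<in> topspace (prod_topology X baire_space). C (f (fst p), snd p)}"
    by (intro closedin_preimage_pred[OF C(1)] continuous_map_fst' f continuous_map_snd)
  then show ?thesis
    by (intro Sigma11I[where C="\<lambda>p. C (f (fst p), snd p)"])
      (simp_all add: C(2) continuous_map_topspace[OF f] cong: conj_cong)
qed

text \<open>Entry 0 of the witness names n and the rest is a witness for \<open>S n\<close>. The
  condition is an intersection over all n of implications, since an infinite union of closed sets
  may fail to be closed.\<close>

lemma Sigma11_UN:
  assumes "\<And>n::nat. S n \<in> Sigma11 X"
  shows "(\<Union>n. S n) \<in> Sigma11 X"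
proof -
  have "\<forall>n. \<exists>C. closedin (prod_topology X baire_space) {p \<in> topspace X \<times> UNIV. C p} \<and>
    (\<forall>x. x \<in> S n \<longleftrightarrow> x \<in> topspace X \<and> (\<exists>\<alpha>. C (x, \<alpha>)))"
    using Sigma11D[OF assms] by blast
  from choice[OF this] obtain C where C: "\<And>n. closedin (prod_topology X baire_space) {p \<in> topspace X \<times> UNIV. C n p}"
    "\<And>n x. x \<in> S n \<longleftrightarrow> x \<in> topspace X \<and> (\<exists>\<alpha>. C n (x, \<alpha>))" by blast
  let ?Z = "prod_topology X baire_space"
  let ?sh = "\<lambda>p::_ \<times> (nat \<Rightarrow> nat). (fst p, \<lambda>i. snd p (Suc i))"
  have snd: "loc_const ?Z (\<lambda>p. snd p i)" for i
    by (intro loc_const_baire continuous_map_snd)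
  have sh: "continuous_map ?Z baire_space (\<lambda>p i. snd p (Suc i))"
    unfolding continuous_map_baire using snd by blast
  have "closedin ?Z {p \<in> topspace ?Z. snd p 0 = n \<longrightarrow> C n (?sh p)}" for n
  proof -
    have "closedin ?Z {p \<in> topspace ?Z. C n (?sh p)}"
      by (rule closedin_preimage_pred[OF C(1) continuous_map_fst sh])
    note cl = this
    have "closedin ?Z ({p \<in> topspace ?Z. snd p 0 \<noteq> n} \<union>
        {p \<in> topspace ?Z. C n (?sh p)})"
      by (rule closedin_Un[OF loc_const_closedin[OF loc_const_comp[OF snd]] cl])
    moreover have "{p \<in> topspace ?Z. snd p 0 = n \<longrightarrow> C n (?sh p)} =
       {p \<in> topspace ?Z. snd p 0 \<noteq> n} \<union> {p \<in> topspace ?Z. C n (?sh p)}" by blast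
    ultimately show ?thesis by (simp only:)
  qed
  then have "closedin ?Z {p \<in> topspace ?Z. \<forall>n. snd p 0 = n \<longrightarrow> C n (?sh p)}"
    by (rule closedin_All)
  then show ?thesis
  proof (intro Sigma11I[where C="\<lambda>p. \<forall>n. snd p 0 = n \<longrightarrow> C n (?sh p)"])
    fix x
    have "\<exists>\<alpha>. C (\<alpha> 0) (x, \<lambda>i. \<alpha> (Suc i))" if "C n (x, \<alpha>)" for n \<alpha>
      using that by (intro exI[of _ "case_nat n \<alpha>"]) simp
    then show "x \<in> (\<Union>n. S n) \<longleftrightarrow> x \<in> topspace X \<and> (\<exists>\<alpha>. \<forall>n. snd (x, \<alpha>) 0 = n \<longrightarrow> C n (?sh (x, \<alpha>)))"
      using C(2) by auto
  qed simp
qed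

text \<open>The pairing function splits one witness into rows, and row n serves
  \<open>S n\<close>.\<close>

lemma Sigma11_INT:
  assumes "\<And>n::nat. S n \<in> Sigma11 X"
  shows "(\<Inter>n. S n) \<in> Sigma11 X"
proof -
  have "\<forall>n. \<exists>C. closedin (prod_topology X baire_space) {p \<in> topspace X \<times> UNIV. C p} \<and>
    (\<forall>x. x \<in> S n \<longleftrightarrow> x \<in> topspace X \<and> (\<exists>\<alpha>. C (x, \<alpha>)))"
    using Sigma11D[OF assms] by blast
  from choice[OF this] obtain C where C: "\<And>n. closedin (prod_topology X baire_space) {p \<in> topspace X \<times> UNIV. C n p}"
    "\<And>n x. x \<in> S n \<longleftrightarrow> x \<in> topspace X \<and> (\<exists>\<alpha>. C n (x, \<alpha>))" by blast
  let ?Z = "prod_topology X baire_space"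
  let ?row = "\<lambda>n \<alpha> i. \<alpha> (prod_encode (n, i)) :: nat"
  have "closedin ?Z {p \<in> topspace ?Z. C n (fst p, ?row n (snd p))}" for n
  proof (intro closedin_preimage_pred[OF C(1) continuous_map_fst])
    show "continuous_map ?Z baire_space (\<lambda>p. ?row n (snd p))"
      unfolding continuous_map_baire by (intro allI loc_const_baire continuous_map_snd)
  qed
  then have "closedin ?Z {p \<in> topspace ?Z. \<forall>n. C n (fst p, ?row n (snd p))}"
    by (rule closedin_All)
  then show ?thesis
  proof (intro Sigma11I[where C="\<lambda>p. \<forall>n. C n (fst p, ?row n (snd p))"])
    fix x
    have "\<exists>\<alpha>. \<forall>n. C n (x, ?row n \<alpha>)" if ex: "\<forall>n. \<exists>\<alpha>. C n (x, \<alpha>)"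
    proof -
      obtain a where "\<And>n. C n (x, a n)" using choice[OF ex] by blast
      then show ?thesis
        by (intro exI[of _ "\<lambda>k. a (fst (prod_decode k)) (snd (prod_decode k))"]) simp
    qed
    then show "x \<in> (\<Inter>n. S n) \<longleftrightarrow> x \<in> topspace X \<and> (\<exists>\<alpha>. \<forall>n. C n (fst (x, \<alpha>), ?row n (snd (x, \<alpha>))))"
      using C(2) by auto
  qed simp
qed

lemma Sigma11_Un: "A \<in> Sigma11 X \<Longrightarrow> B \<in> Sigma11 X \<Longrightarrow> A \<union> B \<in> Sigma11 X"
proof -
  assume "A \<in> Sigma11 X" "B \<in> Sigma11 X"
  then have "(\<Union>n::nat. if n = 0 then A else B) \<in> Sigma11 X" by (intro Sigma11_UN) auto
  moreover have "(\<Union>n::nat. if n = 0 then A else B) = A \<union> B" by (auto split: if_splits)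
  ultimately show ?thesis by simp
qed

lemma Sigma11_Int: "A \<in> Sigma11 X \<Longrightarrow> B \<in> Sigma11 X \<Longrightarrow> A \<inter> B \<in> Sigma11 X"
proof -
  assume "A \<in> Sigma11 X" "B \<in> Sigma11 X"
  then have "(\<Inter>n::nat. if n = 0 then A else B) \<in> Sigma11 X" by (intro Sigma11_INT) auto
  moreover have "(\<Inter>n::nat. if n = 0 then A else B) = A \<inter> B" by (auto split: if_splits)
  ultimately show ?thesis by simp
qed

text \<open>The even entries code the point of the Cantor space and the odd ones the witness.\<close>

lemma Sigma11_proj_cantor:
  assumes "S \<in> Sigma11 (prod_topology X cantor_space)"
  shows "fst ` S \<in> Sigma11 X"
proof -
  obtain C where C: "closedin (prod_topology (prod_topology X cantor_space) baire_space)
      {p \<in> topspace (prod_topology X cantor_space) \<times> UNIV. C p}"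
    "\<And>p. p \<in> S \<longleftrightarrow> p \<in> topspace (prod_topology X cantor_space) \<and> (\<exists>\<alpha>. C (p, \<alpha>))"
    using Sigma11D[OF assms] by blast
  let ?Z = "prod_topology X baire_space"
  let ?f = "\<lambda>p. (fst p, \<lambda>i. snd p (2 * i) \<noteq> (0::nat))" and ?g = "\<lambda>p i. snd p (2 * i + 1) :: nat"
  have snd: "loc_const ?Z (\<lambda>p. snd p i)" for i
    by (intro loc_const_baire continuous_map_snd)
  have "closedin ?Z {p \<in> topspace ?Z. C (?f p, ?g p)}"
  proof (intro closedin_preimage_pred[OF C(1)])
    have "loc_const ?Z (\<lambda>p. snd p (2 * i) \<noteq> 0)" for i by (rule loc_const_comp[OF snd])
    then have "continuous_map ?Z cantor_space (\<lambda>p i. snd p (2 * i) \<noteq> 0)"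
      unfolding continuous_map_cantor by blast
    then show "continuous_map ?Z (prod_topology X cantor_space) ?f"
      by (rule continuous_map_pairedI[OF continuous_map_fst])
    show "continuous_map ?Z baire_space ?g" unfolding continuous_map_baire using snd by blast
  qed
  then show ?thesis
  proof (intro Sigma11I[where C="\<lambda>p. C (?f p, ?g p)"])
    fix x
    have "\<exists>\<alpha>. C (?f (x, \<alpha>), ?g (x, \<alpha>))" if "C ((x, c), \<beta>)" for c \<beta>
      using that
      by (intro exI[of _ "\<lambda>k. if even k then of_bool (c (k div 2)) else \<beta> (k div 2)"]) simp
    then have "(\<exists>c. (x, c) \<in> S) \<longleftrightarrow> x \<in> topspace X \<and> (\<exists>\<alpha>. C (?f (x, \<alpha>), ?g (x, \<alpha>)))"
      unfolding C(2) topspace_prod_topology topspace_cantor mem_Sigma_iff fst_conv by blast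
    moreover have "x \<in> fst ` S \<longleftrightarrow> (\<exists>c. (x, c) \<in> S)" by (auto intro: rev_image_eqI)
    ultimately show "x \<in> fst ` S \<longleftrightarrow> x \<in> topspace X \<and> (\<exists>\<alpha>. C (?f (x, \<alpha>), ?g (x, \<alpha>)))"
      by blast
  qed simp
qed

section \<open>Omega-powers as greatest fixed points\<close>

definition drop_seq :: "nat \<Rightarrow> (nat \<Rightarrow> 'a) \<Rightarrow> nat \<Rightarrow> 'a" where
  "drop_seq n x = (\<lambda>i. x (n + i))"

lemma drop_seq_0 [simp]: "drop_seq 0 x = x"
  by (simp add: drop_seq_def)

lemma drop_seq_drop_seq [simp]: "drop_seq m (drop_seq n x) = drop_seq (n + m) x"
  by (simp add: drop_seq_def add.assoc)

lemma map_drop_seq: "map (drop_seq n x) [a..<b] = map x [n + a..<n + b]"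
  by (rule nth_equalityI) (auto simp: drop_seq_def add.assoc)

lemma upt_append: "a \<le> b \<Longrightarrow> b \<le> c \<Longrightarrow> [a..<b] @ [b..<c] = [a..<c]"
  by (metis le_Suc_ex upt_add_eq_append)

lemma omega_power_slicesI:
  assumes f: "f 0 = 0" "strict_mono f" "\<And>i. map y [f i..<f (Suc i)] \<in> A"
  shows "y \<in> omega_power A"
proof -
  define a where "a i = map y [f i..<f (Suc i)]" for i
  have c: "concat (map a [0..<n]) = map y [0..<f n]" for n
  proof (induction n)
    case (Suc n)
    have "[0..<f (Suc n)] = [0..<f n] @ [f n..<f (Suc n)]"
      using upt_append[of 0 "f n" "f (Suc n)"] strict_monoD[OF f(2), of n "Suc n"] by simp
    then show ?case using Suc by (simp add: a_def)
  qed (simp add: f)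
  have "k \<le> f k" for k using strict_mono_imp_increasing[OF f(2)] .
  then have "inf_concat a y" unfolding inf_concat_def c by auto
  then show ?thesis unfolding omega_power_def using f(3) by (auto simp flip: a_def)
qed

text \<open>Factors may be empty, so the prefix is the first nonempty factor; it exists because the
  lengths of the concatenations are unbounded.\<close>

lemma omega_power_unfold:
  assumes "y \<in> omega_power A"
  shows "\<exists>n>0. map y [0..<n] \<in> A \<and> drop_seq n y \<in> omega_power A"
proof -
  obtain a where a: "\<And>i. a i \<in> A" and "inf_concat a y"
    using assms by (auto simp: omega_power_def)
  then have pre: "\<And>n. concat (map a [0..<n]) = map y [0..<length (concat (map a [0..<n]))]"
    and unb: "\<And>k. \<exists>n. k \<le> length (concat (map a [0..<n]))"
    unfolding inf_concat_def Let_def by blast+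
  have "\<exists>k. a k \<noteq> []"
  proof (rule ccontr)
    assume "\<nexists>k. a k \<noteq> []"
    then have "concat (map a [0..<n]) = []" for n by simp
    then show False using unb[of 1] by (metis list.size(3) not_one_le_zero)
  qed
  then have ex: "a (LEAST k. a k \<noteq> []) \<noteq> []" by (rule LeastI_ex)
  define k where "k = (LEAST k. a k \<noteq> [])"
  have "a j = []" if "j < k" for j using not_less_Least that unfolding k_def by blast
  then have "concat (map a [0..<k]) = []" by simp
  then have split: "concat (map a [0..<Suc k + m]) = a k @ concat (map (\<lambda>i. a (Suc k + i)) [0..<m])" for m
    by (induction m) auto
  define n where "n = length (a k)"
  have eq: "a k = map y [0..<n] \<and> concat (map (\<lambda>i. a (Suc k + i)) [0..<m]) =
      map (drop_seq n y) [0..<length (concat (map (\<lambda>i. a (Suc k + i)) [0..<m]))]" for m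
  proof -
    let ?c = "concat (map (\<lambda>i. a (Suc k + i)) [0..<m])"
    have "a k @ ?c = map y [0..<n + length ?c]"
      using pre[of "Suc k + m"] unfolding split n_def by simp
    also have "\<dots> = map y [0..<n] @ map y [n..<n + length ?c]"
      by (simp add: upt_append flip: map_append)
    also have "map y [n..<n + length ?c] = map (drop_seq n y) [0..<length ?c]"
      by (simp add: map_drop_seq)
    finally show ?thesis by (simp add: n_def)
  qed
  have "\<exists>m. j \<le> length (concat (map (\<lambda>i. a (Suc k + i)) [0..<m]))" for j
  proof -
    obtain m where m: "j + n \<le> length (concat (map a [0..<m]))" using unb by blast
    have "length (concat (map a [0..<m])) \<le> length (concat (map a [0..<Suc k + m]))"
      unfolding add.commute[of "Suc k" m]
      by (simp only: upt_add_eq_append[of 0 m "Suc k"] le0 map_append concat_append length_append)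
    then have "j \<le> length (concat (map (\<lambda>i. a (Suc k + i)) [0..<m]))"
      using m unfolding split length_append n_def by linarith
    then show ?thesis by blast
  qed
  then have "inf_concat (\<lambda>i. a (Suc k + i)) (drop_seq n y)"
    unfolding inf_concat_def Let_def using eq by blast
  then have "drop_seq n y \<in> omega_power A"
    unfolding omega_power_def mem_Collect_eq by (intro exI[of _ "\<lambda>i. a (Suc k + i)"]) (simp add: a)
  moreover have "map y [0..<n] \<in> A" using a[of k] conjunct1[OF eq[of 0]] by (rule back_subst)
  moreover have "n > 0" using ex by (simp add: n_def k_def)
  ultimately show ?thesis by blast
qed

text \<open>The next length is chosen as a function \<open>N\<close> of the remainder alone, so the
  cut points come from a plain recursion along which the remainder stays in B.\<close>

lemma slices_coinduct:
  assumes "y \<in> B" and step: "\<And>y. y \<in> B \<Longrightarrow> \<exists>n>0. map y [0..<n] \<in> A \<and> drop_seq n y \<in> B"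
  shows "\<exists>f. f 0 = 0 \<and> strict_mono f \<and> (\<forall>i. map y [f i..<f (Suc i)] \<in> A)"
proof -
  have "\<forall>y\<in>B. \<exists>n>0. map y [0..<n] \<in> A \<and> drop_seq n y \<in> B" using step by blast
  from bchoice[OF this] obtain N where
    N: "\<And>y. y \<in> B \<Longrightarrow> N y > 0" "\<And>y. y \<in> B \<Longrightarrow> map y [0..<N y] \<in> A"
      "\<And>y. y \<in> B \<Longrightarrow> drop_seq (N y) y \<in> B" by blast
  define f where "f = rec_nat 0 (\<lambda>_ m. m + N (drop_seq m y))"
  have f: "f 0 = 0" "\<And>i. f (Suc i) = f i + N (drop_seq (f i) y)" by (simp_all add: f_def)
  have B: "drop_seq (f i) y \<in> B" for i
    by (induction i) (use assms(1) N(3) in \<open>force simp: f\<close>)+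
  have "strict_mono f" by (simp add: strict_mono_Suc_iff f N(1)[OF B])
  moreover have "map y [f i..<f (Suc i)] \<in> A" for i
    using N(2)[OF B[of i]] by (simp add: map_drop_seq f)
  ultimately show ?thesis using f(1) by blast
qed

lemma omega_power_coinduct:
  assumes "y \<in> B" and "\<And>y. y \<in> B \<Longrightarrow> \<exists>n>0. map y [0..<n] \<in> A \<and> drop_seq n y \<in> B"
  shows "y \<in> omega_power A"
  using slices_coinduct[OF assms] omega_power_slicesI by metis

text \<open>In this form a single point of the Baire space, the sequence of cut points, witnesses
  membership; this makes the relation analytic.\<close>

lemma omega_power_iff_slices:
  "y \<in> omega_power A \<longleftrightarrow> (\<exists>f. f 0 = 0 \<and> strict_mono f \<and> (\<forall>i. map y [f i..<f (Suc i)] \<in> A))"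
  using slices_coinduct[of y "omega_power A" A, OF _ omega_power_unfold] omega_power_slicesI[of _ y A]
  by blast

lemma omega_power_eq_iff:
  "omega_power A = B \<longleftrightarrow>
    omega_power A \<subseteq> B \<and> (\<forall>y\<in>B. \<exists>n>0. map y [0..<n] \<in> A \<and> drop_seq n y \<in> B)"
  using omega_power_unfold omega_power_coinduct[of _ B A] by blast

section \<open>Borel sets\<close>

text \<open>Takes the place of the Borel sets: the class is stable under complements, countable
  unions and continuous preimages, and a diagonal argument applies to it directly.\<close>

definition Delta11 :: "'a topology \<Rightarrow> 'a set set" where
  "Delta11 X = {S \<in> Sigma11 X. topspace X - S \<in> Sigma11 X}"

lemma Delta11_compl: "S \<in> Delta11 X \<Longrightarrow> topspace X - S \<in> Delta11 X"
  using Sigma11_subset[of S X] by (auto simp: Delta11_def double_diff)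

lemma Delta11_preimage:
  assumes "S \<in> Delta11 Y" and f: "continuous_map X Y f"
  shows "{x \<in> topspace X. f x \<in> S} \<in> Delta11 X"
proof -
  have "topspace X - {x \<in> topspace X. f x \<in> S} = {x \<in> topspace X. f x \<in> topspace Y - S}"
    using continuous_map_topspace[OF f] by blast
  then show ?thesis
    using assms(1) Sigma11_preimage[OF _ f] unfolding Delta11_def by (simp only: mem_Collect_eq)
qed

lemma Delta11_UN:
  assumes "\<And>n::nat. S n \<in> Delta11 X"
  shows "(\<Union>n. S n) \<in> Delta11 X"
proof -
  have "topspace X - (\<Union>n. S n) = (\<Inter>n. topspace X - S n)" by auto
  then show ?thesis
    using assms Sigma11_UN[of S X] Sigma11_INT[of "\<lambda>n. topspace X - S n" X]
    unfolding Delta11_def by simp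
qed

lemma Delta11_Int:
  assumes "A \<in> Delta11 X" "B \<in> Delta11 X" shows "A \<inter> B \<in> Delta11 X"
proof -
  have "topspace X - A \<inter> B = (topspace X - A) \<union> (topspace X - B)" by auto
  then show ?thesis using assms Sigma11_Int Sigma11_Un unfolding Delta11_def by auto
qed

lemma Delta11_loc_const:
  assumes "loc_const X P" shows "{x \<in> topspace X. P x} \<in> Delta11 X"
proof -
  have "topspace X - {x \<in> topspace X. P x} = {x \<in> topspace X. \<not> P x}" by auto
  then show ?thesis
    unfolding Delta11_def
    using Sigma11_closedin[OF loc_const_closedin[OF assms]]
      Sigma11_closedin[OF loc_const_closedin[OF loc_const_comp[OF assms, of Not]]] by simp
qed

section \<open>Borel levels and their universal sets\<close>

lemma fin_ord_less: "m < n \<Longrightarrow> fin_ord m < fin_ord n"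
  using fin_ord_below[of n] by blast

lemma borel_level_ge: "borel_level X \<xi> S \<Longrightarrow> fin_ord 1 \<le> \<xi>"
  by (induction rule: borel_level.induct) (auto simp del: fin_ord.simps intro: less_imp_le order.trans)

lemma borel_level_1: "borel_level X (fin_ord 1) S \<longleftrightarrow> openin X S"
  by (subst borel_level.simps) (auto simp del: fin_ord.simps)

lemma borel_level_step:
  assumes "fin_ord 1 < \<xi>"
  shows "borel_level X \<xi> S \<longleftrightarrow> (\<exists>\<eta> T. (\<forall>n::nat. \<eta> n < \<xi> \<and> borel_level X (\<eta> n) (T n)) \<and>
    S = (\<Union>n. topspace X - T n))"
proof
  assume "borel_level X \<xi> S"
  then show "\<exists>\<eta> T. (\<forall>n::nat. \<eta> n < \<xi> \<and> borel_level X (\<eta> n) (T n)) \<and> S = (\<Union>n. topspace X - T n)"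
  proof cases
    case open_level
    then show ?thesis using assms by blast
  next
    case (union_level \<eta> T)
    from union_level(2) show ?thesis by (intro exI[of _ \<eta>] exI[of _ T] conjI union_level(1)) simp
  qed
next
  assume "\<exists>\<eta> T. (\<forall>n::nat. \<eta> n < \<xi> \<and> borel_level X (\<eta> n) (T n)) \<and> S = (\<Union>n. topspace X - T n)"
  then obtain \<eta> T where *: "(\<forall>n::nat. \<eta> n < \<xi> \<and> borel_level X (\<eta> n) (T n)) \<and> S = (\<Union>n. topspace X - T n)"
    by (elim exE)
  then have T: "\<eta> n < \<xi>" "borel_level X (\<eta> n) (T n)" for n by auto
  show "borel_level X \<xi> S"
    unfolding conjunct2[OF *]
    by (rule borel_level.union_level[where \<eta>=\<eta>]) (intro conjI T borel_level_ge[OF T(2)])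
qed

lemma loc_const_prefix: "loc_const cantor_space (\<lambda>x. map x [a..<b])"
  by (intro loc_const_map_upt loc_const_cantor continuous_map_id[unfolded id_def])

lemma openin_cantor:
  "openin cantor_space U \<longleftrightarrow> (\<forall>x\<in>U. \<exists>n. \<forall>y. map y [0..<n] = map x [0..<n] \<longrightarrow> y \<in> U)"
  by (simp add: cantor_space_def openin_seq_space Ball_def)

text \<open>Codes turn the quantifier over Borel sets of one level into a quantifier over the Baire
  space. By induction on the level, a code consists of codes for countably many sets of lower
  levels.\<close>

lemma universal_set:
  assumes "fin_ord 1 \<le> \<xi>"
  shows "\<exists>U\<in>Delta11 (prod_topology baire_space cantor_space).
    Sigma0 \<xi> cantor_space = range (\<lambda>c. {x. (c, x) \<in> U})"
  using assms
proof (induction \<xi> rule: less_induct)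
  case (less \<xi>)
  let ?Z = "prod_topology baire_space cantor_space"
  have fst: "loc_const ?Z (\<lambda>p. fst p i)" for i by (intro loc_const_baire continuous_map_fst)
  show ?case
  proof (cases "\<xi> = fin_ord 1")
    case True
    \<comment> \<open>A code marks, by nonzero values, the words whose cylinders make up the open
      set.\<close>
    define U where "U = (\<Union>n. {p \<in> topspace ?Z. fst p (to_nat (map (snd p) [0..<n])) \<noteq> (0::nat)})"
    have "loc_const ?Z (\<lambda>p. map (snd p) [0..<n])" for n
      by (rule loc_const_compose[OF loc_const_prefix continuous_map_snd])
    then have "loc_const ?Z (\<lambda>p. fst p (to_nat (map (snd p) [0..<n])) \<noteq> (0::nat))" for n
      by (rule loc_const_bind) (rule loc_const_comp[OF fst])
    then have U: "U \<in> Delta11 ?Z"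
      unfolding U_def by (intro Delta11_UN Delta11_loc_const)
    have mem: "(c, x) \<in> U \<longleftrightarrow> (\<exists>n. c (to_nat (map x [0..<n])) \<noteq> 0)" for c x
      by (auto simp: U_def)
    have "openin cantor_space {x. (c, x) \<in> U}" for c
      unfolding openin_cantor mem
    proof
      fix x assume "x \<in> {x. \<exists>n. c (to_nat (map x [0..<n])) \<noteq> 0}"
      then obtain n where n: "c (to_nat (map x [0..<n])) \<noteq> 0" by blast
      have "y \<in> {x. \<exists>n. c (to_nat (map x [0..<n])) \<noteq> 0}" if "map y [0..<n] = map x [0..<n]" for y
        using n unfolding that[symmetric] by blast
      then show "\<exists>n. \<forall>y. map y [0..<n] = map x [0..<n] \<longrightarrow> y \<in> {x. \<exists>n. c (to_nat (map x [0..<n])) \<noteq> 0}"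
        by blast
    qed
    moreover have "\<exists>c. V = {x. (c, x) \<in> U}" if V: "openin cantor_space V" for V
    proof
      let ?c = "\<lambda>k. of_bool (\<forall>y. map y [0..<length (from_nat k :: bool list)] = from_nat k \<longrightarrow> y \<in> V)"
      show "V = {x. (?c, x) \<in> U}"
        using V unfolding mem openin_cantor of_bool_eq_0_iff not_not from_nat_to_nat
          length_map length_upt diff_zero by blast
    qed
    ultimately have "Sigma0 \<xi> cantor_space = range (\<lambda>c. {x. (c, x) \<in> U})"
      unfolding Sigma0_def True borel_level_1 by blast
    then show ?thesis using U by blast
  next
    case False
    then have gt: "fin_ord 1 < \<xi>" using less.prems by simp
    let ?E = "{\<eta>. fin_ord 1 \<le> \<eta> \<and> \<eta> < \<xi>}"
    \<comment> \<open>Here it matters that \<xi> is a countable ordinal: natural numbers can name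
      the levels below it.\<close>
    have "countable ?E" by (rule countable_subset[OF _ countable_below_omega1[of \<xi>]]) auto
    moreover have "?E \<noteq> {}" using gt by auto
    ultimately obtain g :: "nat \<Rightarrow> omega1" where g: "range g = ?E"
      using range_from_nat_into by metis
    have "\<forall>i. \<exists>U\<in>Delta11 ?Z. Sigma0 (g i) cantor_space = range (\<lambda>c. {x. (c, x) \<in> U})"
      using less.IH g by blast
    then obtain W where W: "\<And>i. W i \<in> Delta11 ?Z"
      "\<And>i. Sigma0 (g i) cantor_space = range (\<lambda>c. {x. (c, x) \<in> W i})"
      unfolding Bex_def by (drule_tac choice) blast
    \<comment> \<open>In row n of the code, entry 0 names a level through \<open>g\<close>, and the
      entries from 1 on code a set of that level.\<close>
    let ?row = "\<lambda>n c i. c (prod_encode (n, Suc i)) :: nat"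
    define U where "U = (\<Union>n. \<Union>i. {p \<in> topspace ?Z. fst p (prod_encode (n, 0)) = i} \<inter>
      {p \<in> topspace ?Z. (?row n (fst p), snd p) \<in> topspace ?Z - W i})"
    have "continuous_map ?Z baire_space (\<lambda>p. ?row n (fst p))" for n
      unfolding continuous_map_baire using fst by blast
    then have cont: "continuous_map ?Z ?Z (\<lambda>p. (?row n (fst p), snd p))" for n
      by (rule continuous_map_pairedI[OF _ continuous_map_snd])
    have U: "U \<in> Delta11 ?Z"
      unfolding U_def
      by (intro Delta11_UN Delta11_Int Delta11_preimage[OF Delta11_compl[OF W(1)] cont]
          Delta11_loc_const[OF loc_const_comp[OF fst]])
    have mem: "(c, x) \<in> U \<longleftrightarrow> (\<exists>n. (?row n c, x) \<notin> W (c (prod_encode (n, 0))))" for c x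
      by (auto simp: U_def)
    have "borel_level cantor_space \<xi> {x. (c, x) \<in> U}" for c
    proof -
      let ?\<eta> = "\<lambda>n. g (c (prod_encode (n, 0)))" and ?T = "\<lambda>n. {x. (?row n c, x) \<in> W (c (prod_encode (n, 0)))}"
      have "?T n \<in> Sigma0 (?\<eta> n) cantor_space" for n
        unfolding W(2) by blast
      moreover have "?\<eta> n < \<xi>" for n using g by blast
      moreover have "{x. (c, x) \<in> U} = (\<Union>n. topspace cantor_space - ?T n)"
        by (auto simp: mem)
      ultimately show ?thesis
        unfolding borel_level_step[OF gt] Sigma0_def mem_Collect_eq
        by (intro exI[of _ ?\<eta>] exI[of _ ?T]) simp
    qed
    moreover have "\<exists>c. S = {x. (c, x) \<in> U}" if S: "borel_level cantor_space \<xi> S" for S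
    proof -
      from iffD1[OF borel_level_step[OF gt] S] obtain \<eta> T where
        *: "(\<forall>n::nat. \<eta> n < \<xi> \<and> borel_level cantor_space (\<eta> n) (T n)) \<and>
          S = (\<Union>n. topspace cantor_space - T n)" by (elim exE)
      then have T: "\<eta> n < \<xi>" "borel_level cantor_space (\<eta> n) (T n)"
        "S = (\<Union>n. topspace cantor_space - T n)" for n by auto
      have "\<forall>n. \<exists>i. \<eta> n = g i"
        using T(1) borel_level_ge[OF T(2)] g by blast
      from choice[OF this] obtain i where i: "\<And>n. \<eta> n = g (i n)" by blast
      have "T n \<in> Sigma0 (g (i n)) cantor_space" for n
        using T(2)[of n] i by (simp add: Sigma0_def)
      then have "\<forall>n. \<exists>c. T n = {x. (c, x) \<in> W (i n)}" unfolding W(2) by blast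
      from choice[OF this] obtain d where d: "\<And>n. T n = {x. (d n, x) \<in> W (i n)}" by blast
      define c where "c k = (case prod_decode k of (n, m) \<Rightarrow> case_nat (i n) (d n) m)" for k
      have "S = {x. (c, x) \<in> U}" by (auto simp: mem T(3) d c_def)
      then show ?thesis by blast
    qed
    ultimately have "Sigma0 \<xi> cantor_space = range (\<lambda>c. {x. (c, x) \<in> U})"
      unfolding Sigma0_def by blast
    then show ?thesis using U by blast
  qed
qed

lemma Sigma0_Delta11:
  assumes "S \<in> Sigma0 \<xi> cantor_space" shows "S \<in> Delta11 cantor_space"
proof -
  have "fin_ord 1 \<le> \<xi>" using assms borel_level_ge by (auto simp: Sigma0_def)
  from universal_set[OF this] obtain U where
    U: "U \<in> Delta11 (prod_topology baire_space cantor_space)"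
      "Sigma0 \<xi> cantor_space = range (\<lambda>c. {x. (c, x) \<in> U})" by blast
  then obtain c where "S = {x. (c, x) \<in> U}" using assms by blast
  moreover have "continuous_map cantor_space (prod_topology baire_space cantor_space) (\<lambda>x. (c, x))"
    by (intro continuous_map_pairedI) (auto simp: continuous_map_id[unfolded id_def])
  ultimately show ?thesis using Delta11_preimage[OF U(1), of cantor_space "\<lambda>x. (c, x)"] by simp
qed

lemma Pi0_Delta11: "S \<in> Pi0 \<xi> cantor_space \<Longrightarrow> S \<in> Delta11 cantor_space"
  unfolding Pi0_def using Delta11_compl Sigma0_Delta11 by blast

text \<open>A countable union of closed sets has every level above 1, because the levels of its
  members need only be smaller; this gives \<open>Pi0\<close>. For \<open>Sigma0\<close> the set is
  written as a constant union of complements of one set of level 2, which takes \<xi> \<ge>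
  3.\<close>

lemma Gdelta_levels:
  assumes "\<And>n::nat. openin X (V n)" and "fin_ord 3 \<le> \<xi>"
  shows "(\<Inter>n. V n) \<in> Sigma0 \<xi> X" and "(\<Inter>n. V n) \<in> Pi0 \<xi> X"
proof -
  have compl: "borel_level X \<eta> (\<Union>n. topspace X - V n)" if "fin_ord 1 < \<eta>" for \<eta>
    by (rule borel_level.union_level[where \<eta>="\<lambda>_. fin_ord 1"])
      (use that assms(1) borel_level.open_level in auto)
  have eq: "topspace X - (\<Union>n. topspace X - V n) = (\<Inter>n. V n)"
    using openin_subset[OF assms(1)] by auto
  have lt: "fin_ord 1 < fin_ord 2" "fin_ord 2 < \<xi>"
    using fin_ord_less[of 1 2] fin_ord_less[of 2 3] assms(2) by auto
  have "borel_level X \<xi> (\<Union>n::nat. topspace X - (\<Union>n. topspace X - V n))"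
    by (rule borel_level.union_level[where \<eta>="\<lambda>_. fin_ord 2"])
      (use lt compl[OF lt(1)] in auto)
  then show "(\<Inter>n. V n) \<in> Sigma0 \<xi> X" using eq by (simp add: Sigma0_def)
  show "(\<Inter>n. V n) \<in> Pi0 \<xi> X"
    unfolding Pi0_def Sigma0_def mem_Collect_eq
    by (intro exI[of _ "\<Union>n. topspace X - V n"] conjI eq[symmetric] compl less_trans[OF lt])
qed

section \<open>The upper bound\<close>

lemma omega_power_Sigma11:
  "{p \<in> topspace (prod_topology lang_space cantor_space). snd p \<in> omega_power (fst p)} \<in>
    Sigma11 (prod_topology lang_space cantor_space)"
proof -
  let ?V = "prod_topology lang_space cantor_space"
  let ?Z = "prod_topology ?V baire_space"
  let ?C = "\<lambda>q i. snd q 0 = 0 \<and> snd q i < snd q (Suc i) \<and>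
      map (snd (fst q)) [snd q i..<snd q (Suc i)] \<in> fst (fst q)"
  have f: "loc_const ?Z (\<lambda>q. snd q i)" for i by (intro loc_const_baire continuous_map_snd)
  have "continuous_map ?Z cantor_space (\<lambda>q. snd (fst q))"
    by (intro continuous_map_fst' continuous_map_snd)
  then have x: "loc_const ?Z (\<lambda>q. map (snd (fst q)) [a..<b])" for a b
    by (rule loc_const_compose[OF loc_const_prefix])
  have "continuous_map ?Z lang_space (\<lambda>q. fst (fst q))"
    by (intro continuous_map_fst' continuous_map_fst)
  then have A: "loc_const ?Z (\<lambda>q. w \<in> fst (fst q))" for w
    by (rule loc_const_lang)
  \<comment> \<open>With the cut points frozen to a and b, the test concerns finitely many letters
    and one word of the language. The cut points are then read from the witness one at a
    time.\<close>
  have "loc_const ?Z (\<lambda>q. map (snd (fst q)) [a..<b] \<in> fst (fst q))" for a b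
    by (rule loc_const_bind[OF x A])
  then have "loc_const ?Z (\<lambda>q. u = 0 \<and> a < b \<and> map (snd (fst q)) [a..<b] \<in> fst (fst q))"
    for u a b :: nat by (rule loc_const_comp[where F="\<lambda>v. u = 0 \<and> a < b \<and> v"])
  then have "loc_const ?Z (\<lambda>q. u = 0 \<and> a < snd q (Suc i) \<and>
      map (snd (fst q)) [a..<snd q (Suc i)] \<in> fst (fst q))" for i a and u :: nat
    by (rule loc_const_bind[OF f])
  then have "loc_const ?Z (\<lambda>q. u = 0 \<and> snd q i < snd q (Suc i) \<and>
      map (snd (fst q)) [snd q i..<snd q (Suc i)] \<in> fst (fst q))" for i and u :: nat
    by (rule loc_const_bind[OF f])
  then have "loc_const ?Z (\<lambda>q. ?C q i)" for i
    by (rule loc_const_bind[OF f])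
  then have "closedin ?Z {q \<in> topspace ?Z. \<forall>i. ?C q i}"
    by (intro closedin_All loc_const_closedin)
  then show ?thesis
  proof (intro Sigma11I[where C="\<lambda>q. \<forall>i. ?C q i"])
    fix p :: "bool list set \<times> (nat \<Rightarrow> bool)"
    show "p \<in> {p \<in> topspace ?V. snd p \<in> omega_power (fst p)} \<longleftrightarrow>
        p \<in> topspace ?V \<and> (\<exists>f. \<forall>i. ?C (p, f) i)"
      unfolding omega_power_iff_slices strict_mono_Suc_iff mem_Collect_eq snd_conv fst_conv by blast
  qed simp
qed

text \<open>The equation between an \<open>\<omega>\<close>-power and a Borel set is a coanalytic condition although
  both inclusions are involved: since the \<open>\<omega>\<close>-power is a greatest fixed point, the inclusion of
  the Borel set in it only asks for one factor of every point.\<close>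

lemma coded_langs_Sigma12:
  assumes U: "U \<in> Delta11 (prod_topology baire_space cantor_space)"
  shows "{A. omega_power A \<in> range (\<lambda>c. {x. (c, x) \<in> U})} \<in> Sigma12 lang_space"
proof -
  let ?Z = "prod_topology lang_space baire_space"
  let ?W = "prod_topology ?Z cantor_space"
  let ?B = "prod_topology baire_space cantor_space"
  have c: "continuous_map ?W baire_space (\<lambda>q. snd (fst q))"
    by (intro continuous_map_fst' continuous_map_snd)
  have A: "continuous_map ?W lang_space (\<lambda>q. fst (fst q))"
    by (intro continuous_map_fst' continuous_map_fst)
  have x: "continuous_map ?W cantor_space snd" by (rule continuous_map_snd)
  then have xi: "loc_const ?W (\<lambda>q. snd q i)" for i by (rule loc_const_cantor)
  have d: "continuous_map ?W cantor_space (\<lambda>q. drop_seq n (snd q))" for n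
    unfolding continuous_map_cantor drop_seq_def using xi by blast
  have cx: "continuous_map ?W ?B (\<lambda>q. (snd (fst q), snd q))"
    by (rule continuous_map_pairedI[OF c x])
  have cd: "continuous_map ?W ?B (\<lambda>q. (snd (fst q), drop_seq n (snd q)))" for n
    by (rule continuous_map_pairedI[OF c d])
  have U': "U \<in> Sigma11 ?B" "topspace ?B - U \<in> Sigma11 ?B" using U by (auto simp: Delta11_def)
  \<comment> \<open>A failure of the equation at x has two forms. \<open>P\<close> and
    \<open>Q\<close>: x is in the \<omega>-power but not in the coded set. \<open>Q'\<close>,
    \<open>N\<close> and \<open>D\<close>: x is in the coded set, but no nonempty prefix in the
    language leaves a remainder in the coded set.\<close>
  define P where "P = {q \<in> topspace ?W. (fst (fst q), snd q) \<in>
      {p \<in> topspace (prod_topology lang_space cantor_space). snd p \<in> omega_power (fst p)}}"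
  define Q where "Q = {q \<in> topspace ?W. (snd (fst q), snd q) \<in> topspace ?B - U}"
  define Q' where "Q' = {q \<in> topspace ?W. (snd (fst q), snd q) \<in> U}"
  define N where "N n = {q \<in> topspace ?W. \<not> (n > 0 \<and> map (snd q) [0..<n] \<in> fst (fst q))}" for n
  define D where "D n = {q \<in> topspace ?W. (snd (fst q), drop_seq n (snd q)) \<in> topspace ?B - U}" for n
  have P: "P \<in> Sigma11 ?W"
    unfolding P_def by (rule Sigma11_preimage[OF omega_power_Sigma11 continuous_map_pairedI[OF A x]])
  have "loc_const ?W (\<lambda>q. map (snd q) [0..<n])" for n
    by (rule loc_const_compose[OF loc_const_prefix x])
  then have "loc_const ?W (\<lambda>q. map (snd q) [0..<n] \<in> fst (fst q))" for n
    by (rule loc_const_bind) (rule loc_const_lang[OF A])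
  then have "loc_const ?W (\<lambda>q. \<not> (n > 0 \<and> map (snd q) [0..<n] \<in> fst (fst q)))" for n
    by (rule loc_const_comp[where F="\<lambda>v. \<not> (n > 0 \<and> v)"])
  then have N: "N n \<in> Sigma11 ?W" for n
    unfolding N_def by (intro Sigma11_closedin loc_const_closedin)
  have S: "(P \<inter> Q) \<union> (Q' \<inter> (\<Inter>n. N n \<union> D n)) \<in> Sigma11 ?W"
    by (intro Sigma11_Un Sigma11_Int Sigma11_INT P N)
      (unfold Q_def Q'_def D_def, (rule Sigma11_preimage[OF U'(2) cx] Sigma11_preimage[OF U'(1) cx]
        Sigma11_preimage[OF U'(2) cd])+)
  define bad where "bad = fst ` ((P \<inter> Q) \<union> (Q' \<inter> (\<Inter>n. N n \<union> D n)))"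
  have bad: "bad \<in> Sigma11 ?Z"
    unfolding bad_def by (rule Sigma11_proj_cantor[OF S])
  have "(A, c) \<in> bad \<longleftrightarrow> \<not> omega_power A = {x. (c, x) \<in> U}" for A c
  proof -
    have "(A, c) \<in> bad \<longleftrightarrow> (\<exists>x. ((A, c), x) \<in> (P \<inter> Q) \<union> (Q' \<inter> (\<Inter>n. N n \<union> D n)))"
      unfolding bad_def by (auto intro: rev_image_eqI)
    also have "\<dots> \<longleftrightarrow> (\<exists>x. x \<in> omega_power A \<and> (c, x) \<notin> U \<or>
        (c, x) \<in> U \<and> (\<forall>n. \<not> (n > 0 \<and> map x [0..<n] \<in> A) \<or> (c, drop_seq n x) \<notin> U))"
      by (simp add: P_def Q_def Q'_def N_def D_def)
    also have "\<dots> \<longleftrightarrow> \<not> omega_power A = {x. (c, x) \<in> U}"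
      unfolding omega_power_eq_iff by blast
    finally show ?thesis .
  qed
  moreover have "A \<in> fst ` (topspace ?Z - bad) \<longleftrightarrow> (\<exists>c. (A, c) \<notin> bad)" for A
    by (auto intro: rev_image_eqI)
  ultimately have "{A. omega_power A \<in> range (\<lambda>c. {x. (c, x) \<in> U})} = fst ` (topspace ?Z - bad)"
    by auto
  moreover have "topspace ?Z - bad \<in> Pi11 ?Z" using bad unfolding Pi11_def by blast
  ultimately show ?thesis unfolding Sigma12_def by blast
qed

lemma Sigma_langs_Sigma12:
  assumes "fin_ord 1 \<le> \<xi>" shows "Sigma_langs \<xi> \<in> Sigma12 lang_space"
  using universal_set[OF assms] coded_langs_Sigma12 unfolding Sigma_langs_def by auto

lemma Pi_langs_Sigma12:
  assumes "fin_ord 1 \<le> \<xi>" shows "Pi_langs \<xi> \<in> Sigma12 lang_space"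
proof -
  let ?B = "prod_topology baire_space cantor_space"
  obtain U where U: "U \<in> Delta11 ?B" "Sigma0 \<xi> cantor_space = range (\<lambda>c. {x. (c, x) \<in> U})"
    using universal_set[OF assms] by blast
  have "Pi0 \<xi> cantor_space = (\<lambda>S. UNIV - S) ` Sigma0 \<xi> cantor_space"
    unfolding Pi0_def topspace_cantor by blast
  also have "\<dots> = range (\<lambda>c. {x. (c, x) \<in> topspace ?B - U})"
    unfolding U(2) image_image by (rule image_cong) auto
  finally show ?thesis
    unfolding Pi_langs_def using coded_langs_Sigma12[OF Delta11_compl[OF U(1)]] by simp
qed

section \<open>An analytic set that is not Borel\<close>

text \<open>The list is reversed so that the last entry is outermost in the code. The code of a
  sequence then contains that of its immediate predecessor as a component, and codes grow strictly
  along a branch, which lets them serve as cut points.\<close>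

definition seq_code :: "(nat \<Rightarrow> nat) \<Rightarrow> nat \<Rightarrow> nat" where
  "seq_code b n = list_encode (rev (map b [0..<n]))"

lemma seq_code_0 [simp]: "seq_code b 0 = 0"
  by (simp add: seq_code_def)

lemma seq_code_Suc: "seq_code b (Suc n) = Suc (prod_encode (b n, seq_code b n))"
  by (simp add: seq_code_def)

lemma seq_code_less_Suc: "seq_code b n < seq_code b (Suc n)"
  using le_prod_encode_2[of "seq_code b n" "b n"] by (simp add: seq_code_Suc)

lemma strict_mono_seq_code: "strict_mono (seq_code b)"
  by (simp add: strict_mono_Suc_iff seq_code_less_Suc)

lemma le_seq_code: "n \<le> seq_code b n"
  using strict_mono_imp_increasing[OF strict_mono_seq_code] .

lemma seq_code_eq_iff: "seq_code b n = seq_code c m \<longleftrightarrow> n = m \<and> (\<forall>i<n. b i = c i)"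
proof -
  have "seq_code b n = seq_code c m \<longleftrightarrow> map b [0..<n] = map c [0..<m]"
    unfolding seq_code_def list_encode_eq by simp
  also have "\<dots> \<longleftrightarrow> n = m \<and> (\<forall>i<n. b i = c i)"
    by (auto simp: list_eq_iff_nth_eq)
  finally show ?thesis .
qed

lemma loc_const_seq_code:
  assumes "\<And>i. loc_const X (\<lambda>x. f x i)"
  shows "loc_const X (\<lambda>x. seq_code (f x) n)"
  unfolding seq_code_def using loc_const_map_upt[OF assms] by (rule loc_const_comp)

text \<open>The tree representation: \<open>T\<close> holds the pairs of equally long initial
  segments of points of the closed set, and closedness recovers a pair from all its
  segments.\<close>

lemma Sigma11_baire_normal_form:
  assumes "S \<in> Sigma11 baire_space"
  shows "\<exists>T. S = {z. \<exists>\<gamma>. \<forall>n. (seq_code z n, seq_code \<gamma> n) \<in> T}"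
proof -
  let ?Z = "prod_topology baire_space baire_space"
  obtain C where C: "closedin ?Z {p \<in> topspace baire_space \<times> UNIV. C p}"
    "\<And>z. z \<in> S \<longleftrightarrow> z \<in> topspace baire_space \<and> (\<exists>\<gamma>. C (z, \<gamma>))"
    using Sigma11D[OF assms] by blast
  then have op: "openin ?Z {p. \<not> C p}"
    by (simp add: closedin_def Compl_eq_Diff_UNIV[symmetric] Collect_neg_eq)
  define T where "T = {(seq_code z n, seq_code \<gamma> n) | z \<gamma> n. C (z, \<gamma>)}"
  have "C (z, \<gamma>)" if T: "\<forall>n. (seq_code z n, seq_code \<gamma> n) \<in> T" for z \<gamma>
  proof (rule ccontr)
    assume "\<not> C (z, \<gamma>)"
    with op obtain V W where VW: "openin baire_space V" "openin baire_space W" "z \<in> V" "\<gamma> \<in> W"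
      "V \<times> W \<subseteq> {p. \<not> C p}"
      unfolding openin_prod_topology_alt by (metis mem_Collect_eq)
    obtain n where n: "\<And>y. \<forall>i<n. y i = z i \<Longrightarrow> y \<in> V"
      using VW(1,3) unfolding baire_space_def openin_seq_space by blast
    obtain m where m: "\<And>y. \<forall>i<m. y i = \<gamma> i \<Longrightarrow> y \<in> W"
      using VW(2,4) unfolding baire_space_def openin_seq_space by blast
    obtain z' \<gamma>' k where zg: "C (z', \<gamma>')" "seq_code z (max n m) = seq_code z' k"
      "seq_code \<gamma> (max n m) = seq_code \<gamma>' k"
      using T[rule_format, of "max n m"] unfolding T_def by blast
    then have "z' \<in> V" "\<gamma>' \<in> W"
      by (auto simp: seq_code_eq_iff intro!: n m)
    then show False using zg(1) VW(5) by blast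
  qed
  then have "S = {z. \<exists>\<gamma>. \<forall>n. (seq_code z n, seq_code \<gamma> n) \<in> T}"
    unfolding set_eq_iff mem_Collect_eq C(2) topspace_baire T_def by blast
  then show ?thesis by blast
qed

text \<open>The diagonal of a universal analytic set: z is read as the set of pairs at whose code it
  vanishes, and is tested against the tree representation given by this very set.\<close>

definition diag :: "(nat \<Rightarrow> nat) set" where
  "diag = {z. \<exists>\<gamma>. \<forall>n. z (prod_encode (seq_code z n, seq_code \<gamma> n)) = 0}"

lemma diag_Sigma11: "diag \<in> Sigma11 baire_space"
proof -
  let ?Z = "prod_topology baire_space baire_space"
  have fst: "loc_const ?Z (\<lambda>p. fst p i)" for i by (intro loc_const_baire continuous_map_fst)
  have snd: "loc_const ?Z (\<lambda>p. snd p i)" for i by (intro loc_const_baire continuous_map_snd)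
  have "loc_const ?Z (\<lambda>p. prod_encode (seq_code (fst p) n, seq_code (snd p) n))" for n
    by (rule loc_const_comp2[OF loc_const_seq_code[OF fst] loc_const_seq_code[OF snd]])
  then have "loc_const ?Z (\<lambda>p. fst p (prod_encode (seq_code (fst p) n, seq_code (snd p) n)) = 0)" for n
    by (rule loc_const_bind) (rule loc_const_comp[OF fst])
  then have "closedin ?Z {p \<in> topspace ?Z. \<forall>n. fst p (prod_encode (seq_code (fst p) n, seq_code (snd p) n)) = 0}"
    by (intro closedin_All loc_const_closedin)
  then show ?thesis
    by (intro Sigma11I[where C="\<lambda>p. \<forall>n. fst p (prod_encode (seq_code (fst p) n, seq_code (snd p) n)) = 0"])
      (simp_all add: diag_def)
qed

lemma compl_diag_not_Sigma11: "- diag \<notin> Sigma11 baire_space"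
proof
  assume "- diag \<in> Sigma11 baire_space"
  then obtain T where T: "- diag = {z. \<exists>\<gamma>. \<forall>n. (seq_code z n, seq_code \<gamma> n) \<in> T}"
    using Sigma11_baire_normal_form by blast
  define z where "z k = (if prod_decode k \<in> T then 0 else 1::nat)" for k
  then have "z (prod_encode p) = 0 \<longleftrightarrow> p \<in> T" for p by simp
  then have "z \<in> diag \<longleftrightarrow> z \<in> - diag"
    unfolding T unfolding diag_def by simp
  then show False by simp
qed

lemma diag_not_Delta11: "diag \<notin> Delta11 baire_space"
  using compl_diag_not_Sigma11 by (simp add: Delta11_def Compl_eq_Diff_UNIV)

section \<open>Coding an infinite alphabet by two letters\<close>

definition enc :: "nat list \<Rightarrow> bool list" where
  "enc ls = concat (map (\<lambda>n. replicate n True @ [False]) ls)"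

text \<open>Each letter takes up at least one bit, so \<open>Suc i\<close> letters suffice to reach
  bit i.\<close>

definition enc_seq :: "(nat \<Rightarrow> nat) \<Rightarrow> nat \<Rightarrow> bool" where
  "enc_seq u i = enc (map u [0..<Suc i]) ! i"

lemma enc_Nil [simp]: "enc [] = []"
  by (simp add: enc_def)

lemma enc_Cons: "enc (n # ls) = replicate n True @ False # enc ls"
  by (simp add: enc_def)

lemma enc_append: "enc (ls @ ls') = enc ls @ enc ls'"
  by (simp add: enc_def)

lemma length_enc: "length ls \<le> length (enc ls)"
  by (induction ls) (auto simp: enc_Cons)

lemma last_enc: "ls \<noteq> [] \<Longrightarrow> \<not> last (enc ls)"
  by (cases ls rule: rev_cases) (auto simp: enc_append enc_Cons)

lemma replicate_cancel:
  "replicate m True @ False # r = replicate n True @ False # s \<longleftrightarrow> m = n \<and> r = s"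
proof (induction m arbitrary: n)
  case 0
  then show ?case by (cases n) auto
next
  case (Suc m)
  then show ?case by (cases n) auto
qed

lemma enc_prefix: "length ls = length ls' \<Longrightarrow> enc ls @ r = enc ls' @ r' \<Longrightarrow> ls = ls'"
  by (induction ls ls' rule: list_induct2) (auto simp: enc_Cons replicate_cancel)

lemma inj_enc: "inj enc"
proof (rule injI)
  show "enc ls = enc ls' \<Longrightarrow> ls = ls'" for ls ls'
  proof (induction ls arbitrary: ls')
    case Nil
    then show ?case by (cases ls') (auto simp: enc_Cons)
  next
    case (Cons n ls)
    then show ?case by (cases ls') (auto simp: enc_Cons replicate_cancel)
  qed
qed

lemma enc_map_upt_append:
  "a \<le> b \<Longrightarrow> enc (map u [0..<b]) = enc (map u [0..<a]) @ enc (map u [a..<b])"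
  using upt_append[of 0 a b] by (metis enc_append map_append le0)

lemma enc_map_upt_nth:
  assumes "i < length (enc (map u [0..<a]))"
  shows "enc (map u [0..<a]) ! i = enc_seq u i"
proof -
  have le: "i < length (enc (map u [0..<Suc i]))"
    using length_enc[of "map u [0..<Suc i]"] by simp
  show ?thesis
  proof (cases "a \<le> Suc i")
    case True
    then show ?thesis
      using enc_map_upt_append[OF True, of u] assms by (simp only: enc_seq_def nth_append if_True)
  next
    case False
    then have "Suc i \<le> a" by simp
    then show ?thesis
      using enc_map_upt_append[of "Suc i" a u] le by (simp only: enc_seq_def nth_append if_True)
  qed
qed

lemma enc_seq_prefix:
  "map (enc_seq u) [0..<length (enc (map u [0..<n]))] = enc (map u [0..<n])"
  by (rule nth_equalityI) (auto simp: enc_map_upt_nth)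

text \<open>\<open>enc ls\<close> and the code of equally many letters of u both begin one longer
  prefix of \<open>enc_seq u\<close>. Since each letter is closed by its only False, they agree
  letter by letter.\<close>

lemma enc_seq_prefixD:
  assumes "map (enc_seq u) [0..<n] = enc ls"
  shows "ls = map u [0..<length ls]" and "n = length (enc ls)"
proof -
  show n: "n = length (enc ls)" using arg_cong[OF assms, of length] by simp
  let ?m = "length (enc (map u [0..<length ls]))"
  have "enc ls @ map (enc_seq u) [n..<max n ?m] = map (enc_seq u) [0..<max n ?m]"
    using upt_append[of 0 n "max n ?m"] by (simp flip: assms map_append)
  also have "\<dots> = map (enc_seq u) [0..<?m] @ map (enc_seq u) [?m..<max n ?m]"
    using upt_append[of 0 ?m "max n ?m"] by (simp flip: map_append)
  also have "map (enc_seq u) [0..<?m] = enc (map u [0..<length ls])"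
    by (rule enc_seq_prefix)
  finally show "ls = map u [0..<length ls]"
    by (intro enc_prefix[of ls "map u [0..<length ls]"]) auto
qed

lemma drop_enc_seq:
  "drop_seq (length (enc (map u [0..<m]))) (enc_seq u) = enc_seq (drop_seq m u)"
proof
  fix i
  let ?p = "length (enc (map u [0..<m]))"
  have i: "i < length (enc (map (drop_seq m u) [0..<Suc i]))"
    using length_enc[of "map (drop_seq m u) [0..<Suc i]"] by simp
  have eq: "enc (map u [0..<m + Suc i]) = enc (map u [0..<m]) @ enc (map (drop_seq m u) [0..<Suc i])"
    using enc_map_upt_append[of m "m + Suc i" u] by (simp only: map_drop_seq le_add1 add_0_right)
  have "enc_seq u (?p + i) = enc (map u [0..<m + Suc i]) ! (?p + i)"
    by (rule enc_map_upt_nth[symmetric]) (use i in \<open>simp only: eq length_append add_less_cancel_left\<close>)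
  then show "drop_seq ?p (enc_seq u) i = enc_seq (drop_seq m u) i"
    using enc_map_upt_nth[OF i] unfolding eq by (simp only: drop_seq_def nth_append_length_plus)
qed

text \<open>A prefix of an encoded sequence that encodes a list ends where a letter ends. So one
  factor on either side matches one factor on the other, and coinduction does the rest.\<close>

lemma enc_seq_mem_iff: "enc_seq u \<in> omega_power (enc ` B) \<longleftrightarrow> u \<in> omega_power B"
proof
  assume "u \<in> omega_power B"
  then have "enc_seq u \<in> enc_seq ` omega_power B" by simp
  then show "enc_seq u \<in> omega_power (enc ` B)"
  proof (rule omega_power_coinduct)
    fix y assume "y \<in> enc_seq ` omega_power B"
    then obtain v where v: "v \<in> omega_power B" "y = enc_seq v" by blast
    obtain m where m: "m > 0" "map v [0..<m] \<in> B" "drop_seq m v \<in> omega_power B"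
      using omega_power_unfold[OF v(1)] by blast
    let ?n = "length (enc (map v [0..<m]))"
    have "?n > 0" using length_enc[of "map v [0..<m]"] m(1) unfolding length_map length_upt by linarith
    moreover have "map y [0..<?n] \<in> enc ` B" unfolding v(2) enc_seq_prefix using m(2) by blast
    moreover have "drop_seq ?n y \<in> enc_seq ` omega_power B"
      unfolding v(2) drop_enc_seq using m(3) by blast
    ultimately show "\<exists>n>0. map y [0..<n] \<in> enc ` B \<and> drop_seq n y \<in> enc_seq ` omega_power B"
      by blast
  qed
next
  assume "enc_seq u \<in> omega_power (enc ` B)"
  then have "u \<in> {v. enc_seq v \<in> omega_power (enc ` B)}" by simp
  then show "u \<in> omega_power B"
  proof (rule omega_power_coinduct)
    fix v assume "v \<in> {v. enc_seq v \<in> omega_power (enc ` B)}"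
    then have "\<exists>n>0. map (enc_seq v) [0..<n] \<in> enc ` B \<and> drop_seq n (enc_seq v) \<in> omega_power (enc ` B)"
      by (intro omega_power_unfold) simp
    then obtain n ls where n: "n > 0" "map (enc_seq v) [0..<n] = enc ls" "ls \<in> B"
      "drop_seq n (enc_seq v) \<in> omega_power (enc ` B)" by blast
    note ls = enc_seq_prefixD[OF n(2)]
    have "length ls > 0" using n(1) ls(2) by (cases ls) auto
    moreover have "map v [0..<length ls] \<in> B" using n(3) ls(1) by simp
    moreover have "enc_seq (drop_seq (length ls) v) \<in> omega_power (enc ` B)"
      using n(4) drop_enc_seq[of v "length ls"] unfolding ls(1)[symmetric] ls(2)[symmetric] by simp
    ultimately show "\<exists>n>0. map v [0..<n] \<in> B \<and> drop_seq n v \<in> {v. enc_seq v \<in> omega_power (enc ` B)}"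
      by blast
  qed
qed

lemma enc_seq_surj:
  assumes "\<And>k. \<exists>i\<ge>k. \<not> y i"
  shows "\<exists>u. enc_seq u = y"
proof -
  define d where "d x = (LEAST i. \<not> x i)" for x :: "nat \<Rightarrow> bool"
  \<comment> \<open>\<open>p n\<close> is the start of block n, a run of True closed by one False;
    \<open>d\<close> gives the length of the run.\<close>
  define p where "p = rec_nat 0 (\<lambda>_ m. m + Suc (d (drop_seq m y)))"
  have p: "p 0 = 0" "p (Suc n) = p n + Suc (d (drop_seq (p n) y))" for n by (simp_all add: p_def)
  define u where "u n = d (drop_seq (p n) y)" for n
  have block: "map y [p n..<p (Suc n)] = replicate (u n) True @ [False]" for n
  proof -
    let ?x = "drop_seq (p n) y"
    obtain i where "i \<ge> p n" "\<not> y i" using assms by blast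
    then have "\<not> ?x (i - p n)" by (simp add: drop_seq_def)
    then have "\<not> ?x (u n)" unfolding u_def d_def by (rule LeastI)
    moreover have "?x j" if "j < u n" for j
      using not_less_Least that unfolding u_def d_def by blast
    ultimately have "map ?x [0..<Suc (u n)] = replicate (u n) True @ [False]"
      by (auto intro!: nth_equalityI simp: nth_append less_Suc_eq)
    then show ?thesis unfolding map_drop_seq by (simp add: p u_def)
  qed
  have pre: "map y [0..<p n] = enc (map u [0..<n])" for n
  proof (induction n)
    case (Suc n)
    have "[0..<p n] @ [p n..<p (Suc n)] = [0..<p (Suc n)]"
      by (rule upt_append) (simp_all add: p)
    then have "map y [0..<p (Suc n)] = map y [0..<p n] @ map y [p n..<p (Suc n)]"
      by (simp only: map_append[symmetric])
    then show ?case unfolding Suc block by (simp add: enc_append enc_Cons)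
  qed (simp add: p)
  have "enc_seq u i = y i" for i
  proof -
    have "i < p (Suc i)"
      using length_enc[of "map u [0..<Suc i]"] unfolding pre[symmetric] by simp
    then show ?thesis unfolding enc_seq_def pre[symmetric] by (simp del: upt_Suc)
  qed
  then show ?thesis by blast
qed

text \<open>The code of a nonempty list ends in False, so a product of such codes has infinitely
  many False and is itself an encoded sequence.\<close>

lemma omega_power_enc:
  assumes "[] \<notin> B"
  shows "omega_power (enc ` B) = enc_seq ` omega_power B"
proof
  show "omega_power (enc ` B) \<subseteq> enc_seq ` omega_power B"
  proof
    fix y assume y: "y \<in> omega_power (enc ` B)"
    then obtain f where f: "strict_mono f" "\<And>i. map y [f i..<f (Suc i)] \<in> enc ` B"
      unfolding omega_power_iff_slices by blast
    have "\<exists>i\<ge>k. \<not> y i" for k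
    proof -
      obtain ls where ls: "map y [f k..<f (Suc k)] = enc ls" "ls \<in> B" using f(2) by blast
      have lt: "f k < f (Suc k)" using f(1) by (simp add: strict_mono_Suc_iff)
      have "ls \<noteq> []" using ls(2) assms by blast
      then have "\<not> last (map y [f k..<f (Suc k)])" unfolding ls(1) by (rule last_enc)
      then have "\<not> y (f (Suc k) - 1)" using lt by (simp add: last_map)
      moreover have "k \<le> f (Suc k) - 1"
        using strict_mono_imp_increasing[OF f(1), of k] lt by simp
      ultimately show ?thesis by blast
    qed
    then obtain u where "enc_seq u = y" using enc_seq_surj by blast
    then show "y \<in> enc_seq ` omega_power B" using y enc_seq_mem_iff by blast
  qed
qed (auto simp: enc_seq_mem_iff)

lemma continuous_enc_seq: "continuous_map baire_space cantor_space enc_seq"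
proof -
  have "loc_const baire_space (\<lambda>u. map u [0..<Suc i])" for i
    by (intro loc_const_map_upt loc_const_baire continuous_map_id[unfolded id_def])
  then have "loc_const baire_space (\<lambda>u. enc (map u [0..<Suc i]) ! i)" for i
    by (rule loc_const_comp)
  then show ?thesis unfolding continuous_map_cantor enc_seq_def by blast
qed

text \<open>The k-th open set asks for an encoded prefix that shows a pair in \<open>R\<close> at an
  index at least k. These prefixes are arbitrarily long and end in False, so they also force the
  point to be an encoded sequence.\<close>

lemma enc_seq_Gdelta:
  fixes R :: "nat \<Rightarrow> nat \<Rightarrow> bool"
  shows "\<exists>V. (\<forall>k::nat. openin cantor_space (V k)) \<and>
    enc_seq ` {u. \<forall>k. \<exists>i\<ge>k. R (u i) (u (Suc i))} = (\<Inter>k. V k)"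
proof (intro exI conjI allI)
  let ?E = "\<lambda>k. {ls. \<exists>i\<ge>k. Suc i < length ls \<and> R (ls ! i) (ls ! Suc i)}"
  let ?V = "\<lambda>k. \<Union>ls\<in>?E k. {y \<in> topspace cantor_space. map y [0..<length (enc ls)] = enc ls}"
  fix k
  have "loc_const cantor_space (\<lambda>y. map y [0..<length (enc ls)] = enc ls)" for ls
    by (rule loc_const_comp[OF loc_const_prefix])
  then have "openin cantor_space {y \<in> topspace cantor_space. map y [0..<length (enc ls)] = enc ls}" for ls
    by (rule loc_const_openin)
  then show "openin cantor_space (?V k)" by blast
next
  let ?E = "\<lambda>k. {ls. \<exists>i\<ge>k. Suc i < length ls \<and> R (ls ! i) (ls ! Suc i)}"
  let ?V = "\<lambda>k. \<Union>ls\<in>?E k. {y \<in> topspace cantor_space. map y [0..<length (enc ls)] = enc ls}"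
  show "enc_seq ` {u. \<forall>k. \<exists>i\<ge>k. R (u i) (u (Suc i))} = (\<Inter>k. ?V k)"
  proof (intro equalityI subsetI)
    fix y assume "y \<in> enc_seq ` {u. \<forall>k. \<exists>i\<ge>k. R (u i) (u (Suc i))}"
    then obtain u where u: "y = enc_seq u" "\<And>k. \<exists>i\<ge>k. R (u i) (u (Suc i))" by blast
    show "y \<in> (\<Inter>k. ?V k)"
    proof
      fix k
      obtain i where i: "i \<ge> k" "R (u i) (u (Suc i))" using u(2) by blast
      then have "map u [0..<Suc (Suc i)] \<in> ?E k"
        by (auto intro!: exI[of _ i] simp del: upt_Suc)
      then show "y \<in> ?V k"
        using enc_seq_prefix[of u "Suc (Suc i)"] unfolding u(1) topspace_cantor by blast
    qed
  next
    fix y assume y: "y \<in> (\<Inter>k. ?V k)"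
    then have ls: "\<exists>ls i. i \<ge> k \<and> Suc i < length ls \<and> R (ls ! i) (ls ! Suc i) \<and>
        map y [0..<length (enc ls)] = enc ls" for k by blast
    have "\<exists>i\<ge>k. \<not> y i" for k
    proof -
      obtain ls i where i: "i \<ge> k" "Suc i < length ls" "map y [0..<length (enc ls)] = enc ls"
        using ls by blast
      have "length (enc ls) > Suc k" using i length_enc[of ls] by simp
      moreover from this have "\<not> last (map y [0..<length (enc ls)])"
        unfolding i(3) by (intro last_enc) auto
      moreover have "last (map y [0..<length (enc ls)]) = y (length (enc ls) - 1)"
        using calculation(1) by (subst last_map) (auto simp del: length_greater_0_conv)
      ultimately have "\<not> y (length (enc ls) - 1)" by simp
      then show ?thesis using \<open>length (enc ls) > Suc k\<close> by (intro exI[of _ "length (enc ls) - 1"]) simp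
    qed
    then obtain u where u: "enc_seq u = y" using enc_seq_surj by blast
    have "\<exists>i\<ge>k. R (u i) (u (Suc i))" for k
    proof -
      obtain ls i where i: "i \<ge> k" "Suc i < length ls" "R (ls ! i) (ls ! Suc i)"
        "map y [0..<length (enc ls)] = enc ls" using ls by blast
      have "ls = map u [0..<length ls]" using enc_seq_prefixD(1) i(4) u by blast
      then have "ls ! i = u i" "ls ! Suc i = u (Suc i)"
        using i(2) by (metis Suc_lessD add_0 diff_zero nth_map_upt)+
      then show ?thesis using i by auto
    qed
    then show "y \<in> enc_seq ` {u. \<forall>k. \<exists>i\<ge>k. R (u i) (u (Suc i))}" using u by blast
  qed
qed

section \<open>The reduction\<close>

text \<open>With numbers read as sequence codes, n arises from m by appending the entry c.\<close>

definition child :: "nat \<Rightarrow> nat \<Rightarrow> bool" where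
  "child m n \<longleftrightarrow> (\<exists>c. n = Suc (prod_encode (c, m)))"

lemma child_seq_code_iff:
  "child (seq_code z a) (seq_code w b) \<longleftrightarrow> b = Suc a \<and> (\<forall>i<a. z i = w i)"
proof -
  have "Suc (prod_encode (c, seq_code z a)) = seq_code (z(a := c)) (Suc a)" for c
  proof -
    have "seq_code z a = seq_code (z(a := c)) a" unfolding seq_code_eq_iff by simp
    then show ?thesis by (simp add: seq_code_Suc)
  qed
  then have "child (seq_code z a) (seq_code w b) \<longleftrightarrow> (\<exists>c. seq_code w b = seq_code (z(a := c)) (Suc a))"
    unfolding child_def by simp
  also have "\<dots> \<longleftrightarrow> b = Suc a \<and> (\<forall>i<a. z i = w i)"
    unfolding seq_code_eq_iff by (auto simp: less_Suc_eq)
  finally show ?thesis .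
qed

definition errs :: "nat list set" where
  "errs = {ls. \<exists>i. Suc i < length ls \<and> \<not> child (ls ! i) (ls ! Suc i)}"

definition fst_seq :: "(nat \<Rightarrow> nat) \<Rightarrow> nat \<Rightarrow> nat" where
  "fst_seq \<delta> i = fst (prod_decode (\<delta> i))"

definition snd_seq :: "(nat \<Rightarrow> nat) \<Rightarrow> nat \<Rightarrow> nat" where
  "snd_seq \<delta> i = snd (prod_decode (\<delta> i))"

text \<open>A word stretching from position \<open>seq_code \<delta> n\<close> to position \<open>seq_code \<delta> (Suc n)\<close> is a step from a
  node of length \<open>n\<close> to the child given by \<open>\<delta> n\<close>; the sequence \<open>\<delta>\<close> packs the branches through two
  trees, given by \<open>Q\<close> and by the section of \<open>T\<close> at \<open>z\<close>. As \<open>n \<le> seq_code \<delta> n\<close>, the letters of the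
  word determine as much of \<open>z\<close> as is tested.\<close>

definition steps :: "((nat \<Rightarrow> nat) \<Rightarrow> nat \<Rightarrow> bool) \<Rightarrow> (nat \<times> nat) set \<Rightarrow> nat list set" where
  "steps Q T = {map (seq_code z) [seq_code \<delta> n..<seq_code \<delta> (Suc n)] | z \<delta> n.
    Q (fst_seq \<delta>) n \<and> (seq_code z n, seq_code (snd_seq \<delta>) n) \<in> T}"

lemma Nil_notin_steps_errs: "[] \<notin> steps Q T \<union> errs"
proof -
  have "[] \<noteq> map (seq_code z) [seq_code \<delta> n..<seq_code \<delta> (Suc n)]" for z \<delta> n
    using seq_code_less_Suc[of \<delta> n] by simp
  then have "[] \<notin> steps Q T" unfolding steps_def by blast
  then show ?thesis by (simp add: errs_def)
qed

lemma map_upt_eqD: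
  assumes "map u [a..<b] = map v [c..<d]"
  shows "b - a = d - c" and "j < b - a \<Longrightarrow> u (a + j) = v (c + j)"
proof -
  show l: "b - a = d - c" using arg_cong[OF assms, of length] by simp
  show "u (a + j) = v (c + j)" if "j < b - a"
    using arg_cong[OF assms, of "\<lambda>l. l ! j"] that l by simp
qed

text \<open>Errors at the border of two factors are not lost: the cut points can be chosen anew,
  each factor being prolonged until it contains an error.\<close>

lemma omega_power_errs: "omega_power errs = {u. \<forall>k. \<exists>i\<ge>k. \<not> child (u i) (u (Suc i))}"
proof (intro equalityI subsetI)
  fix u assume "u \<in> omega_power errs"
  then obtain f where f: "strict_mono f" "\<And>i. map u [f i..<f (Suc i)] \<in> errs"
    unfolding omega_power_iff_slices by blast
  have "\<exists>i\<ge>k. \<not> child (u i) (u (Suc i))" for k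
  proof -
    obtain i where i: "Suc i < f (Suc k) - f k" "\<not> child (u (f k + i)) (u (f k + Suc i))"
      using f(2)[of k] unfolding errs_def by auto
    then show ?thesis
      using strict_mono_imp_increasing[OF f(1), of k] by (intro exI[of _ "f k + i"]) simp
  qed
  then show "u \<in> {u. \<forall>k. \<exists>i\<ge>k. \<not> child (u i) (u (Suc i))}" by blast
next
  fix u assume "u \<in> {u. \<forall>k. \<exists>i\<ge>k. \<not> child (u i) (u (Suc i))}"
  then show "u \<in> omega_power errs"
  proof (rule omega_power_coinduct)
    fix v assume "v \<in> {u. \<forall>k. \<exists>i\<ge>k. \<not> child (u i) (u (Suc i))}"
    then have v: "\<exists>i\<ge>k. \<not> child (v i) (v (Suc i))" for k by blast
    obtain i where i: "\<not> child (v i) (v (Suc i))" using v by blast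
    have "map v [0..<Suc (Suc i)] \<in> errs"
      unfolding errs_def mem_Collect_eq by (intro exI[of _ i]) (simp add: i del: upt_Suc)
    moreover have "\<exists>j\<ge>k. \<not> child (drop_seq (Suc (Suc i)) v j) (drop_seq (Suc (Suc i)) v (Suc j))" for k
    proof -
      obtain j where j: "j \<ge> Suc (Suc i) + k" "\<not> child (v j) (v (Suc j))" using v by blast
      obtain l where "j = Suc (Suc i) + (k + l)" using j(1) by (metis le_Suc_ex add.assoc)
      then show ?thesis
        using j(2) by (intro exI[of _ "k + l"]) (simp add: drop_seq_def)
    qed
    ultimately show "\<exists>n>0. map v [0..<n] \<in> errs \<and>
        drop_seq n v \<in> {u. \<forall>k. \<exists>i\<ge>k. \<not> child (u i) (u (Suc i))}"
      by (intro exI[of _ "Suc (Suc i)"]) simp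
  qed
qed

text \<open>Equal codes mean equal lengths and equal entries, so each step lengthens the node by one
  and never changes an entry that is already set.\<close>

lemma walk_branch:
  assumes "\<And>i. seq_code (\<delta> (Suc i)) (n (Suc i)) = seq_code (\<delta> i) (Suc (n i))"
  shows "\<exists>\<beta>. \<forall>i. n i = n 0 + i \<and> (\<forall>j<n i. \<delta> i j = \<beta> j)"
proof -
  have step: "n (Suc i) = Suc (n i)" "j < Suc (n i) \<Longrightarrow> \<delta> (Suc i) j = \<delta> i j" for i j
    using assms[of i] unfolding seq_code_eq_iff by auto
  have n: "n i = n 0 + i" for i by (induction i) (simp_all add: step)
  have stable: "j < n i \<Longrightarrow> \<delta> (i + m) j = \<delta> i j" for i j m
    by (induction m) (simp_all add: step n[of "_ + _"] n[of i])
  have "\<delta> i j = \<delta> (Suc j) j" if "j < n i" for i j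
  proof (cases "i \<le> Suc j")
    case True
    then show ?thesis using stable[OF that, of "Suc j - i"] by simp
  next
    case False
    then show ?thesis using stable[of j "Suc j" "i - Suc j"] n[of "Suc j"] by simp
  qed
  \<comment> \<open>At index \<open>Suc j\<close> the node is longer than j, so its entry j is
    final.\<close>
  then show ?thesis using n by (intro exI[of _ "\<lambda>j. \<delta> (Suc j) j"]) blast
qed

text \<open>A product with finitely many errors has a tail without errors, not even at borders.
  There all factors are steps, each starting at the node where the previous one ended, and the walk
  would yield a branch through the tree of \<open>Q\<close>.\<close>

lemma omega_power_steps_errs_wf:
  assumes mono: "\<And>\<beta> n. Q \<beta> (Suc n) \<Longrightarrow> Q \<beta> n"
    and loc: "\<And>\<beta> \<beta>' n. \<forall>i<n. \<beta> i = \<beta>' i \<Longrightarrow> Q \<beta> n \<Longrightarrow> Q \<beta>' n"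
    and wf: "\<nexists>\<beta>. \<forall>n. Q \<beta> n"
  shows "omega_power (steps Q T \<union> errs) = omega_power errs"
proof
  show "omega_power errs \<subseteq> omega_power (steps Q T \<union> errs)"
    by (auto simp: omega_power_def)
  show "omega_power (steps Q T \<union> errs) \<subseteq> omega_power errs"
  proof (rule subsetI, rule ccontr)
    fix u assume "u \<in> omega_power (steps Q T \<union> errs)" and "u \<notin> omega_power errs"
    then obtain f k where f: "strict_mono f" "\<And>i. map u [f i..<f (Suc i)] \<in> steps Q T \<union> errs"
      and k: "\<And>i. i \<ge> k \<Longrightarrow> child (u i) (u (Suc i))"
      unfolding omega_power_iff_slices omega_power_errs by blast
    \<comment> \<open>Dropping k factors is enough, since at least k letters go with them.\<close>
    define g where "g i = f (k + i)" for i
    have g: "k \<le> g i" "g i < g (Suc i)" for i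
      using strict_mono_imp_increasing[OF f(1), of "k + i"] f(1)
      by (auto simp: g_def strict_mono_Suc_iff)
    have "map u [g i..<g (Suc i)] \<in> steps Q T" for i
    proof -
      have "map u [g i..<g (Suc i)] \<notin> errs"
        using k g(1)[of i] by (auto simp: errs_def)
      then show ?thesis using f(2)[of "k + i"] by (simp add: g_def)
    qed
    then have "\<forall>i. \<exists>z \<delta> n. map u [g i..<g (Suc i)] = map (seq_code z) [seq_code \<delta> n..<seq_code \<delta> (Suc n)] \<and>
        Q (fst_seq \<delta>) n"
      unfolding steps_def mem_Collect_eq by blast
    then obtain z \<delta> n where *: "\<forall>i. map u [g i..<g (Suc i)] =
          map (seq_code (z i)) [seq_code (\<delta> i) (n i)..<seq_code (\<delta> i) (Suc (n i))] \<and> Q (fst_seq (\<delta> i)) (n i)"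
      unfolding choice_iff by (elim exE)
    then have eq: "map u [g i..<g (Suc i)] =
          map (seq_code (z i)) [seq_code (\<delta> i) (n i)..<seq_code (\<delta> i) (Suc (n i))]"
      and Q: "Q (fst_seq (\<delta> i)) (n i)" for i by simp_all
    \<comment> \<open>The letters on the two sides of the border code sequences of lengths
      \<open>seq_code (\<delta> i) (Suc (n i)) - 1\<close> and
      \<open>seq_code (\<delta> (Suc i)) (n (Suc i))\<close>. As there is no error, these lengths
      are consecutive, so the two nodes have equal codes.\<close>
    have "seq_code (\<delta> (Suc i)) (n (Suc i)) = seq_code (\<delta> i) (Suc (n i))" for i
    proof -
      have "u (g i + (g (Suc i) - g i - 1)) = seq_code (z i) (seq_code (\<delta> i) (n i) + (g (Suc i) - g i - 1))"
        by (rule map_upt_eqD(2)[OF eq]) (use g(2)[of i] g(2)[of "Suc i"] in simp)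
      moreover have "g i + (g (Suc i) - g i - 1) = g (Suc i) - 1"
        "seq_code (\<delta> i) (n i) + (g (Suc i) - g i - 1) = seq_code (\<delta> i) (Suc (n i)) - 1"
        using map_upt_eqD(1)[OF eq[of i]] g(2)[of i] by linarith+
      ultimately have last: "u (g (Suc i) - 1) = seq_code (z i) (seq_code (\<delta> i) (Suc (n i)) - 1)"
        by (simp only:)
      have "u (g (Suc i) + 0) = seq_code (z (Suc i)) (seq_code (\<delta> (Suc i)) (n (Suc i)) + 0)"
        by (rule map_upt_eqD(2)[OF eq]) (use g(2)[of i] g(2)[of "Suc i"] in simp)
      moreover have "child (u (g (Suc i) - 1)) (u (g (Suc i)))"
        using k[of "g (Suc i) - 1"] g[of i] by simp
      ultimately have "seq_code (\<delta> (Suc i)) (n (Suc i)) = Suc (seq_code (\<delta> i) (Suc (n i)) - 1)"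
        unfolding last by (simp add: child_seq_code_iff)
      then show ?thesis using seq_code_less_Suc[of "\<delta> i" "n i"] by simp
    qed
    from walk_branch[of \<delta> n, OF this] obtain \<beta> where
      \<beta>: "\<And>i. n i = n 0 + i" "\<And>i j. j < n i \<Longrightarrow> \<delta> i j = \<beta> j" by blast
    have Qn: "Q (fst_seq \<beta>) (n i)" for i
      by (rule loc[OF _ Q[of i]]) (simp add: fst_seq_def \<beta>(2))
    \<comment> \<open>The walk may start at a node of positive length \<open>n 0\<close>; the
      shorter initial segments of the branch follow by monotonicity.\<close>
    have "Q (fst_seq \<beta>) m" for m
    proof -
      have "Q (fst_seq \<beta>) (m + d) \<Longrightarrow> Q (fst_seq \<beta>) m" for d
        by (induction d) (auto dest: mono)
      then show ?thesis using Qn[of m] \<beta>(1)[of m] by (simp add: add.commute)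
    qed
    then show False using wf by blast
  qed
qed

text \<open>The sequence \<open>seq_code z\<close> has no errors, so all factors are steps, and its
  letter at position p codes a sequence of length exactly p. Hence each factor starts at the
  position that is the code of its node, and the walk starts at the root. Conversely, the given
  branch of \<open>Q\<close> is packed with the witness for T.\<close>

lemma seq_code_mem_steps_errs_iff:
  assumes \<beta>: "\<And>n. Q \<beta> n"
  shows "seq_code z \<in> omega_power (steps Q T \<union> errs) \<longleftrightarrow>
    (\<exists>\<gamma>. \<forall>n. (seq_code z n, seq_code \<gamma> n) \<in> T)"
proof
  assume "\<exists>\<gamma>. \<forall>n. (seq_code z n, seq_code \<gamma> n) \<in> T"
  then obtain \<gamma> where \<gamma>: "\<And>n. (seq_code z n, seq_code \<gamma> n) \<in> T" by blast
  define \<delta> where "\<delta> i = prod_encode (\<beta> i, \<gamma> i)" for i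
  have "fst_seq \<delta> = \<beta>" "snd_seq \<delta> = \<gamma>" by (auto simp: fst_seq_def snd_seq_def \<delta>_def)
  then have "map (seq_code z) [seq_code \<delta> i..<seq_code \<delta> (Suc i)] \<in> steps Q T" for i
    unfolding steps_def mem_Collect_eq
    by (intro exI[of _ z] exI[of _ \<delta>] exI[of _ i]) (simp add: \<beta> \<gamma>)
  then show "seq_code z \<in> omega_power (steps Q T \<union> errs)"
    by (intro omega_power_slicesI[of "seq_code \<delta>"] strict_mono_seq_code) auto
next
  assume "seq_code z \<in> omega_power (steps Q T \<union> errs)"
  then obtain f where f: "f 0 = 0" "strict_mono f"
    "\<And>i. map (seq_code z) [f i..<f (Suc i)] \<in> steps Q T \<union> errs"
    unfolding omega_power_iff_slices by blast
  have lt: "f i < f (Suc i)" for i using f(2) by (simp add: strict_mono_Suc_iff)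
  have "map (seq_code z) [a..<b] \<notin> errs" for a b
    by (auto simp: errs_def child_seq_code_iff)
  then have "\<forall>i. \<exists>z' \<delta> n. map (seq_code z) [f i..<f (Suc i)] =
        map (seq_code z') [seq_code \<delta> n..<seq_code \<delta> (Suc n)] \<and>
      (seq_code z' n, seq_code (snd_seq \<delta>) n) \<in> T"
    using f(3) unfolding steps_def by blast
  then obtain z' \<delta> n where *: "\<forall>i. map (seq_code z) [f i..<f (Suc i)] =
        map (seq_code (z' i)) [seq_code (\<delta> i) (n i)..<seq_code (\<delta> i) (Suc (n i))] \<and>
      (seq_code (z' i) (n i), seq_code (snd_seq (\<delta> i)) (n i)) \<in> T"
    unfolding choice_iff by (elim exE)
  then have eq: "map (seq_code z) [f i..<f (Suc i)] =
        map (seq_code (z' i)) [seq_code (\<delta> i) (n i)..<seq_code (\<delta> i) (Suc (n i))]"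
    and T: "(seq_code (z' i) (n i), seq_code (snd_seq (\<delta> i)) (n i)) \<in> T" for i by simp_all
  \<comment> \<open>Only first letters are compared. Equality of their codes identifies the position
    of the factor with its node and makes z agree with \<open>z' i\<close> below that
    position.\<close>
  have "seq_code z (f i + 0) = seq_code (z' i) (seq_code (\<delta> i) (n i) + 0)" for i
    by (rule map_upt_eqD(2)[OF eq]) (use lt in simp)
  then have pos: "f i = seq_code (\<delta> i) (n i)" and agree: "\<And>j. j < f i \<Longrightarrow> z j = z' i j" for i
    unfolding seq_code_eq_iff by auto
  have "f (Suc i) = seq_code (\<delta> i) (Suc (n i))" for i
    using map_upt_eqD(1)[OF eq[of i]] pos[of i] lt[of i] seq_code_less_Suc[of "\<delta> i" "n i"] by simp
  then have "seq_code (\<delta> (Suc i)) (n (Suc i)) = seq_code (\<delta> i) (Suc (n i))" for i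
    using pos[of "Suc i"] by simp
  from walk_branch[of \<delta> n, OF this] obtain b where
    b: "\<And>i. n i = n 0 + i" "\<And>i j. j < n i \<Longrightarrow> \<delta> i j = b j" by blast
  \<comment> \<open>Only the empty sequence has code 0, so the factor at position 0 starts at the
    root.\<close>
  have "n 0 = 0" using le_seq_code[of "n 0" "\<delta> 0"] pos[of 0] f(1) by simp
  then have n: "n i = i" for i using b(1)[of i] by simp
  have "(seq_code z i, seq_code (snd_seq b) i) \<in> T" for i
  proof -
    have "seq_code z i = seq_code (z' i) i"
      using agree[of _ i] le_seq_code[of i "\<delta> i"] pos[of i] by (simp add: seq_code_eq_iff n)
    moreover have "seq_code (snd_seq b) i = seq_code (snd_seq (\<delta> i)) i"
      using b(2)[of _ i] by (simp add: seq_code_eq_iff snd_seq_def n)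
    ultimately show ?thesis using T[of i] by (simp add: n)
  qed
  then show "\<exists>\<gamma>. \<forall>n. (seq_code z n, seq_code \<gamma> n) \<in> T" by blast
qed

section \<open>Clopen bases and trees for analytic sets over a test space\<close>

lemma loc_const_All_less:
  assumes "\<And>m. loc_const X (P m)" shows "loc_const X (\<lambda>x. \<forall>m<n::nat. P m x)"
proof (induction n)
  case (Suc n)
  have "loc_const X (\<lambda>x. (\<forall>m<n. P m x) \<and> P n x)"
    by (rule loc_const_comp2[where F="(\<and>)", OF Suc assms])
  then show ?case by (simp add: All_less_Suc conj_commute)
qed simp

text \<open>The common property through which the test spaces of the hardness claim and the Baire
  space are treated alike.\<close>

definition clopen_base :: "'a topology \<Rightarrow> (nat \<Rightarrow> 'a set) \<Rightarrow> bool" where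
  "clopen_base X K \<longleftrightarrow> (\<forall>n. loc_const X (\<lambda>x. x \<in> K n)) \<and>
    (\<forall>U x. openin X U \<and> x \<in> U \<longrightarrow> (\<exists>n. x \<in> K n \<and> K n \<subseteq> U))"

text \<open>To keep the base countable, one clopen set is chosen for each pair of members of a
  countable base that has a clopen set in between.\<close>

lemma zero_dim_polish_clopen_base:
  assumes "zero_dim_polish X"
  shows "\<exists>K. clopen_base X K"
proof -
  have sc: "second_countable X" and nb: "neighbourhood_base_of (\<lambda>U. closedin X U \<and> openin X U) X"
    using assms by (auto simp: zero_dim_polish_def dimension_le_0_neighbourhood_base_of_clopen)
  obtain \<B> where *: "countable \<B> \<and> (\<forall>V\<in>\<B>. openin X V) \<and>
      (\<forall>U x. openin X U \<and> x \<in> U \<longrightarrow> (\<exists>V\<in>\<B>. x \<in> V \<and> V \<subseteq> U))"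
    using sc unfolding second_countable_def by (elim exE)
  then have \<B>: "countable \<B>" "V \<in> \<B> \<Longrightarrow> openin X V"
    "openin X U \<Longrightarrow> x \<in> U \<Longrightarrow> \<exists>V\<in>\<B>. x \<in> V \<and> V \<subseteq> U" for U V x by simp_all
  define clo where "clo K B B' \<longleftrightarrow> closedin X K \<and> openin X K \<and> B \<subseteq> K \<and> K \<subseteq> B'" for K B B'
  define ch where "ch B B' = (SOME K. clo K B B')" for B B'
  \<comment> \<open>The empty set makes the family nonempty, so that it can be enumerated by all
    natural numbers.\<close>
  define \<K> where "\<K> = insert {} ((\<lambda>(B, B'). ch B B') ` {(B, B') \<in> \<B> \<times> \<B>. \<exists>K. clo K B B'})"
  have "countable {(B, B') \<in> \<B> \<times> \<B>. \<exists>K. clo K B B'}"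
    by (rule countable_subset[OF _ countable_SIGMA[OF \<B>(1) \<B>(1)]]) blast
  then have cK: "countable \<K>" unfolding \<K>_def by (intro countable_insert countable_image)
  have neK: "\<K> \<noteq> {}" by (simp add: \<K>_def)
  define K where "K = from_nat_into \<K>"
  have K: "range K = \<K>" unfolding K_def by (rule range_from_nat_into[OF neK cK])
  have ch: "clo (ch B B') B B'" if "\<exists>K. clo K B B'" for B B'
    using that unfolding ch_def by (rule someI_ex)
  have "loc_const X (\<lambda>x. x \<in> K n)" for n
  proof -
    have "K n \<in> \<K>" using K by blast
    then consider "K n = {}" | B B' where "K n = ch B B'" "\<exists>K. clo K B B'"
      unfolding \<K>_def by auto
    then have "closedin X (K n) \<and> openin X (K n)"
      by cases (use ch clo_def in auto)
    then show ?thesis by (blast intro: loc_const_clopen)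
  qed
  moreover have "\<exists>n. x \<in> K n \<and> K n \<subseteq> U" if U: "openin X U" "x \<in> U" for U x
  proof -
    obtain B' where B': "B' \<in> \<B>" "x \<in> B'" "B' \<subseteq> U" using \<B>(3)[OF U] by blast
    have "\<exists>C V. openin X C \<and> (closedin X V \<and> openin X V) \<and> x \<in> C \<and> C \<subseteq> V \<and> V \<subseteq> B'"
      using nb[unfolded neighbourhood_base_of, rule_format, OF conjI[OF \<B>(2)[OF B'(1)] B'(2)]] .
    then obtain C V where C: "openin X C" "closedin X V" "openin X V" "x \<in> C" "C \<subseteq> V" "V \<subseteq> B'"
      by (elim exE conjE)
    obtain B where B: "B \<in> \<B>" "x \<in> B" "B \<subseteq> C" using \<B>(3)[OF C(1,4)] by blast
    have ex: "\<exists>V. clo V B B'" using B C by (auto simp: clo_def)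
    then have "ch B B' \<in> \<K>" using B(1) B'(1)
      unfolding \<K>_def by (intro insertI2 image_eqI[of _ _ "(B, B')"]) simp_all
    then obtain n where "K n = ch B B'" using K by blast
    then show ?thesis using ch[OF ex] B(2) B'(3) by (intro exI[of _ n]) (auto simp: clo_def)
  qed
  ultimately show ?thesis unfolding clopen_base_def by blast
qed

lemma baire_clopen_base:
  "clopen_base baire_space (\<lambda>n. {x. map x [0..<length (from_nat n :: nat list)] = from_nat n})"
proof -
  have "loc_const baire_space (\<lambda>x. map x [0..<length w])" for w :: "nat list"
    by (intro loc_const_map_upt loc_const_baire continuous_map_id[unfolded id_def])
  then have "loc_const baire_space (\<lambda>x. map x [0..<length w] = w)" for w
    by (rule loc_const_comp)
  moreover have "\<exists>n. x \<in> {x. map x [0..<length (from_nat n :: nat list)] = from_nat n} \<and>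
      {x. map x [0..<length (from_nat n :: nat list)] = from_nat n} \<subseteq> U"
    if U: "openin baire_space U" "x \<in> U" for U and x :: "nat \<Rightarrow> nat"
  proof -
    obtain m where "\<And>y. \<forall>i<m. y i = x i \<Longrightarrow> y \<in> U"
      using U unfolding baire_space_def openin_seq_space by blast
    then show ?thesis by (intro exI[of _ "to_nat (map x [0..<m])"]) auto
  qed
  ultimately show ?thesis unfolding clopen_base_def by simp
qed

text \<open>\<open>Q x \<beta> n\<close> says that the first n base sets and the first n entries of
  \<beta> do not yet show the pair of x and \<beta> to lie off the closed set. These are finitely
  many clopen conditions on x, so the tree of x varies continuously with x.\<close>

lemma Sigma11_clopen_normal_form:
  assumes K: "clopen_base X K" and "S \<in> Sigma11 X"
  shows "\<exists>Q :: 'a \<Rightarrow> (nat \<Rightarrow> nat) \<Rightarrow> nat \<Rightarrow> bool. (\<forall>\<beta> n. loc_const X (\<lambda>x. Q x \<beta> n)) \<and>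
    (\<forall>x \<beta> n. Q x \<beta> (Suc n) \<longrightarrow> Q x \<beta> n) \<and>
    (\<forall>x \<beta> \<beta>' n. (\<forall>i<n. \<beta> i = \<beta>' i) \<longrightarrow> Q x \<beta> n \<longrightarrow> Q x \<beta>' n) \<and>
    (\<forall>x\<in>topspace X. x \<in> S \<longleftrightarrow> (\<exists>\<beta>. \<forall>n. Q x \<beta> n))"
proof -
  let ?Z = "prod_topology X baire_space"
  obtain C where C: "closedin ?Z {p \<in> topspace X \<times> UNIV. C p}"
    "\<And>x. x \<in> S \<longleftrightarrow> x \<in> topspace X \<and> (\<exists>\<alpha>. C (x, \<alpha>))"
    using Sigma11D[OF assms(2)] by blast
  have "openin ?Z (topspace ?Z - {p \<in> topspace X \<times> UNIV. C p})"
    using C(1) by blast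
  moreover have "topspace ?Z - {p \<in> topspace X \<times> UNIV. C p} = {p \<in> topspace X \<times> UNIV. \<not> C p}"
    by auto
  ultimately have op: "openin ?Z {p \<in> topspace X \<times> UNIV. \<not> C p}" by (simp only:)
  define D where "D m \<beta> j \<longleftrightarrow> (\<forall>y\<in>K m. \<forall>\<alpha>. (\<forall>i<j. \<alpha> i = \<beta> i) \<longrightarrow> \<not> C (y, \<alpha>))" for m j :: nat and \<beta>
  \<comment> \<open>As j runs up to n inclusive, the first n entries of \<beta> decide the
    condition.\<close>
  define Q where "Q x \<beta> n \<longleftrightarrow> (\<forall>m<n. \<forall>j<Suc n. D m \<beta> j \<longrightarrow> x \<notin> K m)" for x \<beta> n
  have DK: "D m \<beta> j \<Longrightarrow> D m \<beta>' j" if "\<forall>i<j. \<beta> i = \<beta>' i" for m j \<beta> \<beta>'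
    using that unfolding D_def by auto
  have "loc_const X (\<lambda>x. x \<in> K m)" for m using K by (simp add: clopen_base_def)
  then have "loc_const X (\<lambda>x. D m \<beta> j \<longrightarrow> x \<notin> K m)" for m \<beta> j
    by (rule loc_const_comp)
  then have Q1: "loc_const X (\<lambda>x. Q x \<beta> n)" for \<beta> n
    unfolding Q_def by (intro loc_const_All_less)
  have Q2: "Q x \<beta> (Suc n) \<Longrightarrow> Q x \<beta> n" for x \<beta> n
    unfolding Q_def by (meson less_SucI)
  have Q3: "Q x \<beta>' n" if "\<forall>i<n. \<beta> i = \<beta>' i" "Q x \<beta> n" for x \<beta> \<beta>' n
    unfolding Q_def
  proof (intro allI impI)
    fix m j assume mj: "m < n" "j < Suc n" "D m \<beta>' j"
    have "D m \<beta> j" by (rule DK[OF _ mj(3)]) (use that(1) mj(2) in simp)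
    then show "x \<notin> K m" using that(2) mj unfolding Q_def by blast
  qed
  have Q4: "x \<in> S \<longleftrightarrow> (\<exists>\<beta>. \<forall>n. Q x \<beta> n)" if x: "x \<in> topspace X" for x
  proof
    assume "x \<in> S"
    then obtain \<beta> where "C (x, \<beta>)" using C(2) by blast
    then have "Q x \<beta> n" for n unfolding Q_def D_def by blast
    then show "\<exists>\<beta>. \<forall>n. Q x \<beta> n" by blast
  next
    assume "\<exists>\<beta>. \<forall>n. Q x \<beta> n"
    then obtain \<beta> where \<beta>: "\<And>n. Q x \<beta> n" by blast
    have "C (x, \<beta>)"
    proof (rule ccontr)
      assume "\<not> C (x, \<beta>)"
      then have "(x, \<beta>) \<in> {p \<in> topspace X \<times> UNIV. \<not> C p}" using x by simp
      then obtain V W where VW: "openin X V" "openin baire_space W" "x \<in> V" "\<beta> \<in> W"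
        "V \<times> W \<subseteq> {p \<in> topspace X \<times> UNIV. \<not> C p}"
        using op unfolding openin_prod_topology_alt by meson
      obtain m where m: "x \<in> K m" "K m \<subseteq> V" using K VW(1,3) unfolding clopen_base_def by blast
      obtain j where j: "\<And>y. \<forall>i<j. y i = \<beta> i \<Longrightarrow> y \<in> W"
        using VW(2,4) unfolding baire_space_def openin_seq_space by blast
      have "D m \<beta> j" unfolding D_def using j m(2) VW(5) by blast
      \<comment> \<open>A stage at which base set m is listed and length j is reached.\<close>
      moreover have "m < max (Suc m) j" "j < Suc (max (Suc m) j)" by auto
      ultimately show False using \<beta>[of "max (Suc m) j"] m(1) unfolding Q_def by blast
    qed
    then show "x \<in> S" using C(2) x by blast
  qed
  show ?thesis
  proof (intro exI conjI)
    show "\<forall>\<beta> n. loc_const X (\<lambda>x. Q x \<beta> n)" by (intro allI Q1)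
    show "\<forall>x \<beta> n. Q x \<beta> (Suc n) \<longrightarrow> Q x \<beta> n" by (intro allI impI) (rule Q2)
    show "\<forall>x \<beta> \<beta>' n. (\<forall>i<n. \<beta> i = \<beta>' i) \<longrightarrow> Q x \<beta> n \<longrightarrow> Q x \<beta>' n"
      by (intro allI impI) (rule Q3)
    show "\<forall>x\<in>topspace X. x \<in> S \<longleftrightarrow> (\<exists>\<beta>. \<forall>n. Q x \<beta> n)" by (intro ballI Q4)
  qed
qed

text \<open>\<open>F\<close> does not mention \<xi>. The two alternatives stay apart on all levels
  from 3 on, because G-delta sets belong to all of these classes and sets outside
  \<open>Delta11\<close> to none.\<close>

lemma coanalytic_reduction:
  assumes K: "clopen_base X K" and "A' \<in> Pi11 X"
  shows "\<exists>F. continuous_map X lang_space F \<and>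
    (\<forall>x\<in>topspace X. if x \<in> A'
      then \<forall>\<xi>\<ge>fin_ord 3. omega_power (F x) \<in> Sigma0 \<xi> cantor_space \<and> omega_power (F x) \<in> Pi0 \<xi> cantor_space
      else omega_power (F x) \<notin> Delta11 cantor_space)"
proof -
  obtain S where S: "S \<in> Sigma11 X" "A' = topspace X - S"
    using assms(2) unfolding Pi11_def by blast
  obtain Q :: "'a \<Rightarrow> (nat \<Rightarrow> nat) \<Rightarrow> nat \<Rightarrow> bool" where *: "(\<forall>\<beta> n. loc_const X (\<lambda>x. Q x \<beta> n)) \<and>
    (\<forall>x \<beta> n. Q x \<beta> (Suc n) \<longrightarrow> Q x \<beta> n) \<and>
    (\<forall>x \<beta> \<beta>' n. (\<forall>i<n. \<beta> i = \<beta>' i) \<longrightarrow> Q x \<beta> n \<longrightarrow> Q x \<beta>' n) \<and>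
    (\<forall>x\<in>topspace X. x \<in> S \<longleftrightarrow> (\<exists>\<beta>. \<forall>n. Q x \<beta> n))"
    using Sigma11_clopen_normal_form[OF K S(1)] by (elim exE)
  have Q_clopen: "loc_const X (\<lambda>x. Q x \<beta> n)"
    and Q_mono: "Q x \<beta> (Suc n) \<Longrightarrow> Q x \<beta> n"
    and Q_loc: "\<forall>i<n. \<beta> i = \<beta>' i \<Longrightarrow> Q x \<beta> n \<Longrightarrow> Q x \<beta>' n"
    and Q_S: "x \<in> topspace X \<Longrightarrow> x \<in> S \<longleftrightarrow> (\<exists>\<beta>. \<forall>n. Q x \<beta> n)" for x \<beta> \<beta>' n
    using * by blast+
  obtain T where T: "diag = {z. \<exists>\<gamma>. \<forall>n. (seq_code z n, seq_code \<gamma> n) \<in> T}"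
    using Sigma11_baire_normal_form[OF diag_Sigma11] by blast
  define F where "F x = enc ` (steps (Q x) T \<union> errs)" for x
  \<comment> \<open>The first letter of a step has length \<open>seq_code \<delta> n\<close>, so the
    word determines n and the first n entries of \<delta>. Membership thus comes down to the single
    test \<open>Q x (fst_seq \<delta>) n\<close>, which is clopen in x.\<close>
  have "loc_const X (\<lambda>x. ls \<in> steps (Q x) T)" for ls
  proof (cases "\<exists>z \<delta> n. ls = map (seq_code z) [seq_code \<delta> n..<seq_code \<delta> (Suc n)] \<and>
      (seq_code z n, seq_code (snd_seq \<delta>) n) \<in> T")
    case True
    then obtain z \<delta> n where ls: "ls = map (seq_code z) [seq_code \<delta> n..<seq_code \<delta> (Suc n)]"
      "(seq_code z n, seq_code (snd_seq \<delta>) n) \<in> T" by blast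
    have "ls \<in> steps (Q x) T \<longleftrightarrow> Q x (fst_seq \<delta>) n" for x
    proof
      assume "ls \<in> steps (Q x) T"
      then obtain z' \<delta>' n' where ls': "ls = map (seq_code z') [seq_code \<delta>' n'..<seq_code \<delta>' (Suc n')]"
        "Q x (fst_seq \<delta>') n'" unfolding steps_def by blast
      have "seq_code z (seq_code \<delta> n + 0) = seq_code z' (seq_code \<delta>' n' + 0)"
        by (rule map_upt_eqD(2)[OF trans[OF ls(1)[symmetric] ls'(1)]])
          (use seq_code_less_Suc[of \<delta> n] in simp)
      then have "n' = n" "\<forall>i<n. \<delta>' i = \<delta> i" unfolding add_0_right seq_code_eq_iff by auto
      then show "Q x (fst_seq \<delta>) n"
        using Q_loc[of n "fst_seq \<delta>'" "fst_seq \<delta>" x] ls'(2) by (simp add: fst_seq_def)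
    next
      assume "Q x (fst_seq \<delta>) n"
      then show "ls \<in> steps (Q x) T" unfolding steps_def using ls by blast
    qed
    then show ?thesis using Q_clopen by simp
  next
    case False
    then have "ls \<notin> steps (Q x) T" for x unfolding steps_def by blast
    then show ?thesis by simp
  qed
  then have mem: "loc_const X (\<lambda>x. ls \<in> steps (Q x) T \<or> ls \<in> errs)" for ls
    by (rule loc_const_comp)
  have "loc_const X (\<lambda>x. w \<in> F x)" for w
  proof (cases "w \<in> range enc")
    case True
    then obtain ls where "w = enc ls" by blast
    then have "w \<in> F x \<longleftrightarrow> ls \<in> steps (Q x) T \<or> ls \<in> errs" for x
      unfolding F_def by (simp add: inj_image_mem_iff[OF inj_enc])
    then show ?thesis using mem by simp
  next
    case False
    then have "w \<notin> F x" for x unfolding F_def by blast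
    then show ?thesis by simp
  qed
  then have "continuous_map X lang_space F" unfolding continuous_map_lang by blast
  moreover have "omega_power (F x) \<in> Sigma0 \<xi> cantor_space \<and> omega_power (F x) \<in> Pi0 \<xi> cantor_space"
    if x: "x \<in> topspace X" "x \<in> A'" and \<xi>: "fin_ord 3 \<le> \<xi>" for x \<xi>
  proof -
    have "\<nexists>\<beta>. \<forall>n. Q x \<beta> n" using Q_S[OF x(1)] x(2) S(2) by blast
    with Q_mono Q_loc have "omega_power (steps (Q x) T \<union> errs) = omega_power errs"
      by (rule omega_power_steps_errs_wf)
    then have eq: "omega_power (F x) = enc_seq ` {u. \<forall>k. \<exists>i\<ge>k. \<not> child (u i) (u (Suc i))}"
      unfolding F_def omega_power_enc[OF Nil_notin_steps_errs] by (simp add: omega_power_errs)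
    obtain V where V: "\<And>k::nat. openin cantor_space (V k)"
      "enc_seq ` {u. \<forall>k. \<exists>i\<ge>k. \<not> child (u i) (u (Suc i))} = (\<Inter>k. V k)"
      using enc_seq_Gdelta[of "\<lambda>m n. \<not> child m n"] by blast
    show ?thesis
      unfolding eq V(2) using Gdelta_levels[of cantor_space V, OF V(1) \<xi>] by simp
  qed
  moreover have "omega_power (F x) \<notin> Delta11 cantor_space" if x: "x \<in> topspace X" "x \<notin> A'" for x
  proof
    assume D: "omega_power (F x) \<in> Delta11 cantor_space"
    obtain \<beta> where \<beta>: "\<And>n. Q x \<beta> n" using Q_S[OF x(1)] x S(2) by blast
    have "enc_seq (seq_code z) \<in> omega_power (F x) \<longleftrightarrow> z \<in> diag" for z
      unfolding F_def enc_seq_mem_iff seq_code_mem_steps_errs_iff[of "Q x", OF \<beta>] T by blast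
    moreover have "continuous_map baire_space baire_space seq_code"
      unfolding continuous_map_baire
      by (intro allI loc_const_seq_code loc_const_baire continuous_map_id[unfolded id_def])
    then have "continuous_map baire_space cantor_space (\<lambda>z. enc_seq (seq_code z))"
      using continuous_map_compose[OF _ continuous_enc_seq] by (simp add: o_def)
    from Delta11_preimage[OF D this] have "{z. enc_seq (seq_code z) \<in> omega_power (F x)} \<in> Delta11 baire_space"
      by simp
    ultimately show False using diag_not_Delta11 by simp
  qed
  ultimately show ?thesis by (intro exI[of _ F]) simp
qed

lemma coanalytic_reduction_langs:
  assumes "clopen_base X K" "A' \<in> Pi11 X" "fin_ord 3 \<le> \<xi>"
  shows "\<exists>F. continuous_map X lang_space F \<and> A' = {x \<in> topspace X. F x \<in> Sigma_langs \<xi>} \<and>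
    A' = {x \<in> topspace X. F x \<in> Pi_langs \<xi>}"
proof -
  obtain F where F: "continuous_map X lang_space F"
    "\<And>x. x \<in> topspace X \<Longrightarrow> if x \<in> A'
      then \<forall>\<xi>\<ge>fin_ord 3. omega_power (F x) \<in> Sigma0 \<xi> cantor_space \<and> omega_power (F x) \<in> Pi0 \<xi> cantor_space
      else omega_power (F x) \<notin> Delta11 cantor_space"
    using coanalytic_reduction[OF assms(1,2)] by blast
  have "A' \<subseteq> topspace X" using assms(2) by (auto simp: Pi11_def)
  moreover have "x \<in> A' \<longleftrightarrow> F x \<in> Sigma_langs \<xi>" "x \<in> A' \<longleftrightarrow> F x \<in> Pi_langs \<xi>" if "x \<in> topspace X" for x
    using F(2)[OF that] assms(3) Sigma0_Delta11 Pi0_Delta11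
    unfolding Sigma_langs_def Pi_langs_def mem_Collect_eq by (metis (full_types))+
  ultimately show ?thesis using F(1) by (intro exI[of _ F]) blast
qed

theorem corollary6p4:
  fixes \<xi> :: omega1
  assumes "fin_ord 3 \<le> \<xi>"
  shows "class_hard (Pi11 :: 'b topology \<Rightarrow> 'b set set) lang_space (Sigma_langs \<xi>) \<and>
         class_hard (Pi11 :: 'b topology \<Rightarrow> 'b set set) lang_space (Pi_langs \<xi>) \<and>
         Sigma_langs \<xi> \<in> Sigma12 lang_space - Sigma11 lang_space \<and>
         Pi_langs \<xi> \<in> Sigma12 lang_space - Sigma11 lang_space"
proof -
  have hard: "\<exists>F. continuous_map X lang_space F \<and> A' = {x \<in> topspace X. F x \<in> Sigma_langs \<xi>} \<and>
      A' = {x \<in> topspace X. F x \<in> Pi_langs \<xi>}"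
    if "zero_dim_polish X \<and> A' \<in> Pi11 X" for X :: "'b topology" and A'
    using zero_dim_polish_clopen_base coanalytic_reduction_langs[OF _ _ assms] that by blast
  \<comment> \<open>Hardness speaks of test spaces on the type \<open>'b\<close> only. So the
    reduction is applied separately to the Baire space, where \<open>- diag\<close> is coanalytic
    but not analytic.\<close>
  have "- diag \<in> Pi11 baire_space"
    unfolding Pi11_def using diag_Sigma11 by (auto simp: Compl_eq_Diff_UNIV)
  then obtain F where F: "continuous_map baire_space lang_space F"
    "- diag = {x \<in> topspace baire_space. F x \<in> Sigma_langs \<xi>}"
    "- diag = {x \<in> topspace baire_space. F x \<in> Pi_langs \<xi>}"
    using coanalytic_reduction_langs[OF baire_clopen_base _ assms] by blast
  have "Sigma_langs \<xi> \<notin> Sigma11 lang_space"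
    using Sigma11_preimage[OF _ F(1), of "Sigma_langs \<xi>"] compl_diag_not_Sigma11
    unfolding F(2)[symmetric] by blast
  moreover have "Pi_langs \<xi> \<notin> Sigma11 lang_space"
    using Sigma11_preimage[OF _ F(1), of "Pi_langs \<xi>"] compl_diag_not_Sigma11
    unfolding F(3)[symmetric] by blast
  moreover have "fin_ord 1 \<le> \<xi>"
    using fin_ord_less[of 1 3] assms by simp
  moreover have "class_hard (Pi11 :: 'b topology \<Rightarrow> 'b set set) lang_space (Sigma_langs \<xi>)"
    "class_hard (Pi11 :: 'b topology \<Rightarrow> 'b set set) lang_space (Pi_langs \<xi>)"
    unfolding class_hard_def topspace_lang by (intro conjI subset_UNIV allI impI; drule hard; blast)+
  ultimately show ?thesis
    using Sigma_langs_Sigma12 Pi_langs_Sigma12 by blast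
qed

end
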